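(* Let $n\ge1$ and $\alpha,\beta,\gamma\in\,]0,1]$. The Markov chain $X^0_{\alpha\beta\gamma}$ on $\Omega^0_n$ has a unique stationary distribution, and for every $\omega\in\Omega^0_n$ (and any initial distribution) $$\mathrm{Prob}(X^0_{\alpha\beta\gamma}(t)=\omega)\xrightarrow[t\to\infty]{}\frac{q(\omega)}{Z^0_n},\qquad Z^0_n=\sum_{\omega'\in\Omega^0_n}q(\omega').$$
   Context: A complete configuration of length $n$ is a pair of rows (top, bottom) of $n$ cells, each containing a black ($\bullet$) or white ($\circ$) particle, such that the two rows together contain $n$ black and $n$ white particles and for every $j$ the first $j$ columns contain at least as many black as white particles; $\Omega^0_n$ is their set. Columns are numbered $1,\dots,n$, wall $i\in\{0,\dots,n\}$ between columns $i$ and $i+1$ (wall $0$ = left border, wall $n$ = right border); $t_c,b_c$ are the top and bottom particles of column $c$. The map $T:\Omega^0_n\times\{0,\dots,n\}\to\Omega^0_n$ is defined by cases (unmentioned particles keep their relative order in their row): (a') $1\le i\le n-1$, $t_i=\bullet$, $t_{i+1}=\circ$, $b_{i+1}=\bullet$: with $j_1$ the smallest $j\in\{0,\dots,i-1\}$ such that $t_{j+1},\dots,t_{i-1}$ are white, remove column $i+1$ and reinsert it as column $j_1+1$. (a'') $1\le i\le n-1$, $t_i=\bullet$, $t_{i+1}=\circ$, $b_{i+1}=\circ$: with $j_2$ the largest $j\in\{i+1,\dots,n\}$ such that $t_{i+2},\dots,t_j$ are black, delete $t_i$ and insert a black particle as top cell $j_2$; delete $b_{i+1}$ and insert a white particle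 as bottom cell $j_2+1$ if $j_2<n$, bottom cell $n$ if $j_2=n$. (b) $i=0$, $t_1=\circ$: with $j_2$ the largest $j\in\{1,\dots,n\}$ such that $t_2,\dots,t_j$ are black, delete column $1$, insert a black particle as top cell $j_2$ and a white particle as bottom cell $j_2+1$ if $j_2<n$, bottom cell $n$ if $j_2=n$. (c) $i=n$, $t_n=\bullet$: with $j_1$ the smallest $j\in\{0,\dots,n-1\}$ such that $t_{j+1},\dots,t_{n-1}$ are white, delete column $n$ and insert a column ($\circ$ on top, $\bullet$ below) as column $j_1+1$. (d) otherwise $T(\omega,i)=\omega$. The chain $X^0_{\alpha\beta\gamma}$: at each step choose $i$ uniformly in $\{0,\dots,n\}$; the next state is $T(X^0_{\alpha\beta\gamma}(t),i)$ with probability $\lambda(i)$ and the current state otherwise, where $\lambda(i)=\alpha$ for $1\le i\le n-1$, $\lambda(0)=\beta$, $\lambda(n)=\gamma$. Weights: the concatenation of complete configurations is a complete configuration; a nonempty complete configuration is prime if it is not a concatenation of two nonempty complete configurations. Every $\omega$ factors uniquely as a concatenation of primes, which are of three kinds: a single column with $\bullet$ on top and $\circ$ below, a single column with $\circ$ on top and $\bullet$ below, or a block $|{\bullet\atop\bullet}|\,\omega'\,|{\circ\atop\circ}|$ (a column with two black particles, a complete configuration $\omega'$ called the inside of the block, and a column with two white particles). Labels are put on bottom-row particles: each white bottom particle not contained in a block gets label $z$; then each black bottom particle that is not in the inside of a block and has no $z$-label to its left gets label $y$. Let $n_y(\omega),n_z(\omega)$ be the numbers of $y$- and $z$-labels,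 and $q(\omega)=\alpha^{n_y(\omega)+n_z(\omega)}\beta^{\,n-n_y(\omega)}\gamma^{\,n-n_z(\omega)}$. *)

theory Defs
  imports "HOL-Probability.Probability"
begin

datatype particle = Black | White

text \<open>A configuration is the pair (top row, bottom row). Cells, columns and walls are numbered as in
  the mathematics: cells \<open>1..n\<close>, wall \<open>i\<close> between columns \<open>i\<close> and \<open>i + 1\<close>.\<close>

type_synonym config = "particle list \<times> particle list"

definition ncols :: "config \<Rightarrow> nat" where
  "ncols \<omega> = length (fst \<omega>)"

definition complete_configs :: "nat \<Rightarrow> config set" where
  "complete_configs n = {(t, b). length t = n \<and> length b = n
     \<and> count_list t Black + count_list b Black = n
     \<and> count_list t White + count_list b White = n
     \<and> (\<forall>j\<le>n. count_list (take j t) White + count_list (take j b) White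
              \<le> count_list (take j t) Black + count_list (take j b) Black)}"

definition complete :: "config \<Rightarrow> bool" where
  "complete \<omega> \<longleftrightarrow> (\<exists>n. \<omega> \<in> complete_configs n)"

definition cell :: "particle list \<Rightarrow> nat \<Rightarrow> particle" where
  "cell r c = r ! (c - 1)"

definition delete_cell :: "nat \<Rightarrow> particle list \<Rightarrow> particle list" where
  "delete_cell c r = take (c - 1) r @ drop c r"

text \<open>The inserted particle becomes cell \<open>c\<close> of the resulting row.\<close>

definition insert_cell :: "nat \<Rightarrow> particle \<Rightarrow> particle list \<Rightarrow> particle list" where
  "insert_cell c x r = take (c - 1) r @ x # drop (c - 1) r"

definition left_wall :: "particle list \<Rightarrow> nat \<Rightarrow> nat" where
  "left_wall t i = Min {j \<in> {0..i - 1}. \<forall>k\<in>{j + 1..i - 1}. cell t k = White}"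

definition right_wall :: "particle list \<Rightarrow> nat \<Rightarrow> nat" where
  "right_wall t i = Max {j \<in> {i + 1..length t}. \<forall>k\<in>{i + 2..j}. cell t k = Black}"

definition T :: "config \<Rightarrow> nat \<Rightarrow> config" where
  "T \<omega> i = (case \<omega> of (t, b) \<Rightarrow>
     let n = length t; j1 = left_wall t i; j2 = right_wall t i in
     if 1 \<le> i \<and> i \<le> n - 1 \<and> cell t i = Black \<and> cell t (i + 1) = White \<and> cell b (i + 1) = Black
     then (insert_cell (j1 + 1) (cell t (i + 1)) (delete_cell (i + 1) t),
           insert_cell (j1 + 1) (cell b (i + 1)) (delete_cell (i + 1) b))
     else if 1 \<le> i \<and> i \<le> n - 1 \<and> cell t i = Black \<and> cell t (i + 1) = White \<and> cell b (i + 1) = White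
     then (insert_cell j2 Black (delete_cell i t),
           insert_cell (if j2 < n then j2 + 1 else n) White (delete_cell (i + 1) b))
     else if i = 0 \<and> cell t 1 = White
     then (insert_cell j2 Black (delete_cell 1 t),
           insert_cell (if j2 < n then j2 + 1 else n) White (delete_cell 1 b))
     else if i = n \<and> cell t n = Black
     then (insert_cell (j1 + 1) White (delete_cell n t),
           insert_cell (j1 + 1) Black (delete_cell n b))
     else \<omega>)"

definition rate :: "nat \<Rightarrow> real \<Rightarrow> real \<Rightarrow> real \<Rightarrow> nat \<Rightarrow> real" where
  "rate n \<alpha> \<beta> \<gamma> i = (if i = 0 then \<beta> else if i = n then \<gamma> else \<alpha>)"

definition step :: "nat \<Rightarrow> real \<Rightarrow> real \<Rightarrow> real \<Rightarrow> config \<Rightarrow> config pmf" where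
  "step n \<alpha> \<beta> \<gamma> \<omega> =
     bind_pmf (pmf_of_set {0..n}) (\<lambda>i.
       map_pmf (\<lambda>accept. if accept then T \<omega> i else \<omega>) (bernoulli_pmf (rate n \<alpha> \<beta> \<gamma> i)))"

text \<open>The law of the state of the chain at a given time, for the initial distribution \<open>\<mu>\<close>.\<close>

primrec chain :: "nat \<Rightarrow> real \<Rightarrow> real \<Rightarrow> real \<Rightarrow> config pmf \<Rightarrow> nat \<Rightarrow> config pmf" where
  "chain n \<alpha> \<beta> \<gamma> \<mu> 0 = \<mu>"
| "chain n \<alpha> \<beta> \<gamma> \<mu> (Suc s) = bind_pmf (chain n \<alpha> \<beta> \<gamma> \<mu> s) (step n \<alpha> \<beta> \<gamma>)"

definition stationary :: "nat \<Rightarrow> real \<Rightarrow> real \<Rightarrow> real \<Rightarrow> config pmf \<Rightarrow> bool" where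
  "stationary n \<alpha> \<beta> \<gamma> \<pi> \<longleftrightarrow>
     set_pmf \<pi> \<subseteq> complete_configs n \<and> bind_pmf \<pi> (step n \<alpha> \<beta> \<gamma>) = \<pi>"

definition cat :: "config \<Rightarrow> config \<Rightarrow> config" where
  "cat u v = (fst u @ fst v, snd u @ snd v)"

definition cats :: "config list \<Rightarrow> config" where
  "cats us = foldr cat us ([], [])"

definition prime_config :: "config \<Rightarrow> bool" where
  "prime_config u \<longleftrightarrow> complete u \<and> u \<noteq> ([], []) \<and>
     \<not> (\<exists>v w. complete v \<and> complete w \<and> v \<noteq> ([], []) \<and> w \<noteq> ([], []) \<and> u = cat v w)"

definition is_block :: "config \<Rightarrow> bool" where
  "is_block u \<longleftrightarrow>
     (\<exists>v. complete v \<and> u = cat ([Black], [Black]) (cat v ([White], [White])))"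

definition prime_factors_of :: "config \<Rightarrow> config list \<Rightarrow> bool" where
  "prime_factors_of \<omega> us \<longleftrightarrow> (\<forall>u\<in>set us. prime_config u) \<and> cats us = \<omega>"

definition in_block :: "config \<Rightarrow> nat \<Rightarrow> bool" where
  "in_block \<omega> c \<longleftrightarrow> (\<exists>us u vs. prime_factors_of \<omega> (us @ u # vs) \<and> is_block u \<and>
     ncols (cats us) + 1 \<le> c \<and> c \<le> ncols (cats us) + ncols u)"

text \<open>The inside of a block omits its first and its last column.\<close>

definition in_inside :: "config \<Rightarrow> nat \<Rightarrow> bool" where
  "in_inside \<omega> c \<longleftrightarrow> (\<exists>us u vs. prime_factors_of \<omega> (us @ u # vs) \<and> is_block u \<and>
     ncols (cats us) + 1 < c \<and> c < ncols (cats us) + ncols u)"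

definition z_label :: "config \<Rightarrow> nat \<Rightarrow> bool" where
  "z_label \<omega> c \<longleftrightarrow> c \<in> {1..ncols \<omega>} \<and> cell (snd \<omega>) c = White \<and> \<not> in_block \<omega> c"

definition y_label :: "config \<Rightarrow> nat \<Rightarrow> bool" where
  "y_label \<omega> c \<longleftrightarrow> c \<in> {1..ncols \<omega>} \<and> cell (snd \<omega>) c = Black \<and> \<not> in_inside \<omega> c \<and>
     (\<forall>d<c. \<not> z_label \<omega> d)"

definition n_y :: "config \<Rightarrow> nat" where
  "n_y \<omega> = card {c. y_label \<omega> c}"

definition n_z :: "config \<Rightarrow> nat" where
  "n_z \<omega> = card {c. z_label \<omega> c}"

definition q :: "real \<Rightarrow> real \<Rightarrow> real \<Rightarrow> config \<Rightarrow> real" where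
  "q \<alpha> \<beta> \<gamma> \<omega> =
     \<alpha> ^ (n_y \<omega> + n_z \<omega>) * \<beta> ^ (ncols \<omega> - n_y \<omega>) * \<gamma> ^ (ncols \<omega> - n_z \<omega>)"

definition Z :: "nat \<Rightarrow> real \<Rightarrow> real \<Rightarrow> real \<Rightarrow> real" where
  "Z n \<alpha> \<beta> \<gamma> = (\<Sum>\<omega>\<in>complete_configs n. q \<alpha> \<beta> \<gamma> \<omega>)"

end

theory Submission
  imports Defs
begin

text \<open>If the particle to the left of wall \<open>i\<close> is black and the one to its right is white, then \<open>T\<close> takes a black and
  a white particle out of the configuration and puts such a pair back next to another wall \<open>j\<close>. Let \<open>R\<close> be
  the configuration of length \<open>n - 1\<close> in between. Following the labels one finds
  \<open>q \<omega> \<lambda>(i) = \<alpha> \<beta> \<gamma> q R = q (T \<omega> i) \<lambda>(j)\<close>. The map \<open>(\<omega>, i) \<mapsto> (T \<omega> i, j)\<close> is onto, since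
  every deletion can be undone, hence it is a bijection of a finite set that preserves the weights
  \<open>q \<omega> \<lambda>(i)\<close>, and summing over the preimages of \<open>\<omega>'\<close> shows that \<open>q / Z\<close> is stationary. Convergence
  and uniqueness follow from Doeblin's contraction argument, because the state with an all-black top row
  is reachable from every state and has a self-loop.\<close>

section \<open>Excess and prime factors\<close>

text \<open>The factor \<alpha> \<beta> \<gamma> arises because putting a pair back raises the
  length by one. At an inner wall no label appears or disappears, so q gains \<beta> \<gamma> and
  the rate supplies \<alpha>. At wall 0 the new column carries a new y-label, so q gains \<alpha>
  \<gamma> and the rate supplies \<beta>. At the right border the new column carries a new z-label,
  so q gains \<alpha> \<beta> and the rate supplies \<gamma>. The obstacle is that labels are
  defined by quantifying over prime factorisations, whereas a deletion is a local change. Labels are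
  therefore rewritten in terms of the excess (blacks minus whites in a prefix): a prime factor ends
  exactly where the excess returns to 0, and the label counts become recursions over the columns
  that carry this height along. Rows are replaced by one list of columns, where each case of
  \<open>T\<close> is a splitting of the list; the same splittings read from right to left produce
  preimages.\<close>

primrec val :: "particle \<Rightarrow> int" where
  "val Black = 1"
| "val White = -1"

type_synonym column = "particle \<times> particle"

definition col :: "column \<Rightarrow> int" where
  "col c = val (fst c) + val (snd c)"

definition excess :: "column list \<Rightarrow> int" where
  "excess cs = sum_list (map col cs)"

text \<open>Columns that complete a configuration whose first columns have excess \<open>h\<close>.\<close>

primrec balanced :: "int \<Rightarrow> column list \<Rightarrow> bool" where
  "balanced h [] \<longleftrightarrow> h = 0"
| "balanced h (c # cs) \<longleftrightarrow> 0 \<le> h + col c \<and> balanced (h + col c) cs"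

definition config_of :: "column list \<Rightarrow> config" where
  "config_of cs = (map fst cs, map snd cs)"

lemma col_simps [simp]:
  "col (Black, Black) = 2" "col (Black, White) = 0" "col (White, Black) = 0" "col (White, White) = -2"
  by (simp_all add: col_def)

lemma excess_simps [simp]:
  "excess [] = 0" "excess (c # cs) = col c + excess cs" "excess (as @ cs) = excess as + excess cs"
  by (simp_all add: excess_def)

text \<open>The recursion tests the height only after each column; the instance \<open>j = 0\<close>
  is what the assumption \<open>0 \<le> h\<close> supplies.\<close>

lemma balanced_iff:
  "0 \<le> h \<Longrightarrow> balanced h cs \<longleftrightarrow> h + excess cs = 0 \<and> (\<forall>j\<le>length cs. 0 \<le> h + excess (take j cs))"
proof (induction cs arbitrary: h)
  case Nil
  then show ?case by auto
next
  case (Cons c cs)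
  have *: "(\<forall>j\<le>length (c # cs). 0 \<le> h + excess (take j (c # cs))) \<longleftrightarrow>
      (\<forall>j\<le>length cs. 0 \<le> h + col c + excess (take j cs))"
  proof -
    have "(\<forall>j\<le>Suc (length cs). P j) \<longleftrightarrow> P 0 \<and> (\<forall>j\<le>length cs. P (Suc j))" for P
      unfolding less_Suc_eq_le[symmetric] by (rule All_less_Suc2)
    from this[of "\<lambda>j. 0 \<le> h + excess (take j (c # cs))"] Cons.prems
    show ?thesis
      by (simp only: length_Cons take_0 take_Suc_Cons excess_simps add_0_right simp_thms add.assoc)
  qed
  show ?case
  proof (cases "0 \<le> h + col c")
    case True
    have "balanced h (c # cs) \<longleftrightarrow>
        h + col c + excess cs = 0 \<and> (\<forall>j\<le>length cs. 0 \<le> h + col c + excess (take j cs))"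
      using Cons.IH[OF True] True by simp
    then show ?thesis unfolding * by (simp only: excess_simps add.assoc)
  next
    case False
    then have "\<not> (\<forall>j\<le>length cs. 0 \<le> h + col c + excess (take j cs))"
      using take_0 excess_simps(1) by (metis add_0_right le0)
    then show ?thesis using False unfolding * by simp
  qed
qed

section \<open>Complete configurations as lists of columns\<close>

lemma excess_conv_count:
  "excess cs = int (count_list (map fst cs) Black + count_list (map snd cs) Black)
     - int (count_list (map fst cs) White + count_list (map snd cs) White)"
proof (induction cs)
  case (Cons c cs)
  then show ?case by (cases c; cases "fst c"; cases "snd c") (auto simp: col_def)
qed simp

lemma count_particles: "count_list t Black + count_list t White = length t"
proof (induction t)
  case (Cons a t)
  then show ?case by (cases a) auto
qed simp

text \<open>Each row has \<open>n\<close> cells, so blacks and whites total \<open>2 * n\<close>,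
  and having \<open>n\<close> of each colour amounts to excess 0.\<close>

lemma config_of_in_complete_configs [simp]:
  "config_of cs \<in> complete_configs n \<longleftrightarrow> length cs = n \<and> balanced 0 cs"
proof -
  have "count_list (map fst cs) Black + count_list (map fst cs) White = length cs"
       "count_list (map snd cs) Black + count_list (map snd cs) White = length cs"
    using count_particles[of "map fst cs"] count_particles[of "map snd cs"] by simp_all
  moreover have "(count_list (take j (map fst cs)) White + count_list (take j (map snd cs)) White
      \<le> count_list (take j (map fst cs)) Black + count_list (take j (map snd cs)) Black) \<longleftrightarrow>
      0 \<le> excess (take j cs)" for j
    unfolding excess_conv_count[of "take j cs"] take_map by linarith
  moreover have "balanced 0 cs \<longleftrightarrow> excess cs = 0 \<and> (\<forall>j\<le>length cs. 0 \<le> excess (take j cs))"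
    by (simp add: balanced_iff)
  ultimately show ?thesis
    unfolding complete_configs_def config_of_def excess_conv_count[of cs]
    by (simp only: mem_Collect_eq prod.case length_map) auto
qed

lemma inj_config_of: "inj config_of"
proof (rule injI)
  fix as cs assume "config_of as = config_of cs"
  then have "zip (map fst as) (map snd as) = zip (map fst cs) (map snd cs)"
    by (simp add: config_of_def)
  then show "as = cs" by (simp only: zip_map_fst_snd)
qed

lemma config_of_eq_iff [simp]: "config_of as = config_of cs \<longleftrightarrow> as = cs"
  using inj_config_of by (auto dest: injD)

lemma complete_configs_eq: "complete_configs n = config_of ` {cs. length cs = n \<and> balanced 0 cs}"
proof (intro equalityI subsetI)
  fix \<omega> assume \<omega>: "\<omega> \<in> complete_configs n"
  obtain t b where tb: "\<omega> = (t, b)" by fastforce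
  have "\<omega> = config_of (zip t b)"
    using \<omega> by (auto simp: tb config_of_def complete_configs_def)
  then show "\<omega> \<in> config_of ` {cs. length cs = n \<and> balanced 0 cs}"
    using \<omega> by auto
qed auto

lemma complete_config_of [simp]: "complete (config_of cs) \<longleftrightarrow> balanced 0 cs"
  by (simp add: complete_def)

lemma complete_iff: "complete v \<longleftrightarrow> (\<exists>cs. v = config_of cs \<and> balanced 0 cs)"
  by (auto simp: complete_def complete_configs_eq)

lemma cat_config_of: "cat (config_of as) (config_of cs) = config_of (as @ cs)"
  by (simp add: cat_def config_of_def)

lemma config_of_Nil: "config_of cs = ([], []) \<longleftrightarrow> cs = []"
  by (simp add: config_of_def)

lemma cats_config_of: "cats (map config_of css) = config_of (concat css)"
  by (induction css) (simp_all add: cats_def config_of_def cat_def)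

lemma ncols_config_of [simp]: "ncols (config_of cs) = length cs"
  by (simp add: ncols_def config_of_def)

lemma balanced_append: "balanced h (as @ cs) \<Longrightarrow> h + excess as = 0 \<Longrightarrow> balanced h as \<and> balanced 0 cs"
proof (induction as arbitrary: h)
  case (Cons a as)
  show ?case using Cons.IH[of "h + col a"] Cons.prems by simp
qed simp

lemma balanced_excess: "balanced h cs \<Longrightarrow> h + excess cs = 0"
proof (induction cs arbitrary: h)
  case (Cons c cs)
  show ?case using Cons.IH[of "h + col c"] Cons.prems by simp
qed simp

text \<open>Parity turns a positive excess into one of at least 2, which forces a longer prime to
  start with a column of two black particles.\<close>

lemma even_excess: "even (excess cs)"
proof (induction cs)
  case (Cons c cs)
  have "even (col c)" by (cases c; cases "fst c"; cases "snd c") auto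
  with Cons show ?case by simp
qed simp

section \<open>Prime factors and zeros of the excess\<close>

lemma exists_prime_factors:
  assumes "balanced 0 cs"
  shows "\<exists>css. concat css = cs \<and> (\<forall>u\<in>set css. prime_config (config_of u))"
  using assms
proof (induction "length cs" arbitrary: cs rule: less_induct)
  case less
  consider "cs = []" | "prime_config (config_of cs)" | "cs \<noteq> []" "\<not> prime_config (config_of cs)"
    by blast
  then show ?case
  proof cases
    case 1
    then show ?thesis by (intro exI[of _ "[]"]) simp
  next
    case 2
    then show ?thesis by (intro exI[of _ "[cs]"]) simp
  next
    case 3
    then obtain v' w' where "complete v'" "complete w'" "v' \<noteq> ([], [])" "w' \<noteq> ([], [])"
        "config_of cs = cat v' w'"
      using less.prems unfolding prime_config_def by (auto simp only: complete_config_of config_of_Nil)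
    then obtain v w where vw: "balanced 0 v" "balanced 0 w" "v \<noteq> []" "w \<noteq> []" "cs = v @ w"
      unfolding complete_iff by (metis cat_config_of config_of_Nil config_of_eq_iff)
    then obtain vs ws where "concat vs = v" "\<forall>u\<in>set vs. prime_config (config_of u)"
        "concat ws = w" "\<forall>u\<in>set ws. prime_config (config_of u)"
      using less.hyps[of v] less.hyps[of w] by auto
    then show ?thesis using vw by (intro exI[of _ "vs @ ws"]) auto
  qed
qed

lemma prime_balanced: "prime_config (config_of u) \<Longrightarrow> u \<noteq> [] \<and> balanced 0 u"
  by (simp only: prime_config_def complete_config_of config_of_Nil) simp

text \<open>The boundaries of the prime factors are exactly the prefixes of excess 0, so membership in a block
  or in the inside of a block can be read off the excess.\<close>

lemma prime_excess_eq_0_iff: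
  assumes "prime_config (config_of u)" "j \<le> length u"
  shows "excess (take j u) = 0 \<longleftrightarrow> j = 0 \<or> j = length u"
proof
  assume 0: "excess (take j u) = 0"
  have "balanced 0 u" using assms prime_balanced by blast
  then have "balanced 0 (take j u)" "balanced 0 (drop j u)"
    using balanced_append[of 0 "take j u" "drop j u"] 0 by auto
  then have "take j u = [] \<or> drop j u = []"
    using assms(1) unfolding prime_config_def
    by (metis append_take_drop_id cat_config_of complete_config_of config_of_Nil)
  then show "j = 0 \<or> j = length u" using assms(2) by auto
next
  assume "j = 0 \<or> j = length u"
  then show "excess (take j u) = 0"
    using assms prime_balanced balanced_excess[of 0 u] by auto
qed

text \<open>Strictly between its ends a prime has positive and even excess, hence at least 2. So the
  first column raises the height by 2 and the last lowers it by 2, and the columns between them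
  never fall below height 2; lowered by 2 they form a complete configuration.\<close>

lemma prime_is_block_iff:
  assumes "prime_config (config_of u)"
  shows "is_block (config_of u) \<longleftrightarrow> length u \<ge> 2"
proof
  assume "is_block (config_of u)"
  then obtain v where "config_of u = cat ([Black], [Black]) (cat v ([White], [White]))"
    by (auto simp: is_block_def)
  then have "map fst u = Black # fst v @ [White]"
    by (simp add: config_of_def cat_def)
  then have "length u = length (Black # fst v @ [White])" by (metis length_map)
  then show "length u \<ge> 2" by simp
next
  assume len: "length u \<ge> 2"
  have bal: "balanced 0 u" using assms prime_balanced by blast
  obtain a u' where u': "u = a # u'" using len by (cases u) auto
  obtain v c where v: "u' = v @ [c]" using len u' by (cases u' rule: rev_cases) auto
  have pos: "0 \<le> excess (take j u)" if "j \<le> length u" for j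
    using bal that by (simp add: balanced_iff)
  have nz: "excess (take j u) \<ge> 2" if "0 < j" "j < length u" for j
  proof -
    have "excess (take j u) \<noteq> 0"
      using prime_excess_eq_0_iff[OF assms] that by auto
    moreover have "even (excess (take j u))" by (rule even_excess)
    ultimately show ?thesis using pos[of j] that by (auto elim!: evenE)
  qed
  have "col a \<ge> 2" using nz[of 1] len by (simp add: u' v)
  then have a: "a = (Black, Black)" by (cases a; cases "fst a"; cases "snd a") auto
  have "excess (take (length u - 1) u) \<ge> 2" using nz[of "length u - 1"] len by simp
  moreover have "excess u = 0" using balanced_excess[OF bal] by simp
  ultimately have "col c \<le> -2" by (simp add: u' v)
  then have c: "c = (White, White)" by (cases c; cases "fst c"; cases "snd c") auto
  have "balanced 0 v"
  proof -
    have "excess v = 0" using \<open>excess u = 0\<close> by (simp add: u' v a c)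
    moreover have "0 \<le> excess (take j v)" if "j \<le> length v" for j
      using nz[of "Suc j"] that by (simp add: u' v a)
    ultimately show ?thesis by (simp add: balanced_iff)
  qed
  moreover have "config_of u = cat ([Black], [Black]) (cat (config_of v) ([White], [White]))"
    by (simp add: u' v a c config_of_def cat_def)
  ultimately show "is_block (config_of u)" unfolding is_block_def using complete_config_of by blast
qed

lemma prime_factors_config_of:
  assumes "prime_factors_of (config_of cs) us"
  obtains css where "us = map config_of css" "cs = concat css"
    "\<forall>u\<in>set css. prime_config (config_of u)"
proof -
  have "\<exists>css. us = map config_of css \<and> (\<forall>u\<in>set css. prime_config (config_of u))"
    if "\<forall>u\<in>set us. prime_config u" for us
    using that
  proof (induction us)
    case (Cons u us)
    then obtain css where css: "us = map config_of css" "\<forall>u\<in>set css. prime_config (config_of u)" by auto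
    have "complete u" using Cons.prems by (simp add: prime_config_def)
    then obtain v where "u = config_of v" by (auto simp: complete_iff)
    then show ?case using css Cons.prems by (intro exI[of _ "v # css"]) auto
  qed simp
  then obtain css where css: "us = map config_of css" "\<forall>u\<in>set css. prime_config (config_of u)"
    using assms by (auto simp: prime_factors_of_def)
  moreover have "cs = concat css"
    using assms by (simp add: prime_factors_of_def css cats_config_of)
  ultimately show ?thesis using that by blast
qed

lemma excess_concat_primes:
  "\<forall>u\<in>set css. prime_config (config_of u) \<Longrightarrow> excess (concat css) = 0"
proof (induction css)
  case (Cons u css)
  then show ?case using prime_balanced[of u] balanced_excess[of 0 u] by simp
qed simp

lemma concat_split_at:
  "k < length (concat css) \<Longrightarrow>
    \<exists>us u vs. css = us @ u # vs \<and> length (concat us) \<le> k \<and> k < length (concat us) + length u"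
proof (induction css arbitrary: k)
  case (Cons w css)
  show ?case
  proof (cases "k < length w")
    case True
    then show ?thesis by (intro exI[of _ "[]"] exI[of _ w] exI[of _ css]) simp
  next
    case False
    then have "k - length w < length (concat css)" using Cons.prems by simp
    then obtain us u vs where "css = us @ u # vs" "length (concat us) \<le> k - length w"
        "k - length w < length (concat us) + length u"
      using Cons.IH by blast
    then show ?thesis
      using False by (intro exI[of _ "w # us"] exI[of _ u] exI[of _ vs]) auto
  qed
qed simp

text \<open>Within the factor \<open>u\<close> containing column \<open>c\<close> only the empty and
  the full prefix have excess 0, so a zero before or after \<open>c\<close> detects the first or
  last column of \<open>u\<close>.\<close>

lemma factor_excess:
  assumes "\<forall>u\<in>set (us @ u # vs). prime_config (config_of u)"
    and "cs = concat (us @ u # vs)"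
    and "length (concat us) < c" "c \<le> length (concat us) + length u"
  shows "excess (take (c - 1) cs) = 0 \<longleftrightarrow> c = length (concat us) + 1"
    and "excess (take c cs) = 0 \<longleftrightarrow> c = length (concat us) + length u"
proof -
  have h0: "excess (concat us) = 0" using assms(1) excess_concat_primes[of us] by auto
  have p: "prime_config (config_of u)" using assms(1) by simp
  have *: "excess (take (length (concat us) + j) cs) = 0 \<longleftrightarrow> j = 0 \<or> j = length u"
    if "j \<le> length u" for j
    using prime_excess_eq_0_iff[OF p that] that by (simp add: assms(2) h0)
  show "excess (take (c - 1) cs) = 0 \<longleftrightarrow> c = length (concat us) + 1"
    using *[of "c - 1 - length (concat us)"] assms(3,4) by auto
  show "excess (take c cs) = 0 \<longleftrightarrow> c = length (concat us) + length u"
    using *[of "c - length (concat us)"] assms(3,4) by auto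
qed

text \<open>A column outside all blocks is a prime by itself, with excess 0 on both sides; in the
  inside of a block neither side is a factor boundary. The definitions ask for some factorisation,
  but every factorisation has its boundaries at the same zeros of the excess.\<close>

lemma in_block_in_inside_iff:
  assumes bal: "balanced 0 cs" and c: "c \<in> {1..length cs}"
  shows in_block_iff: "in_block (config_of cs) c \<longleftrightarrow>
      \<not> (excess (take (c - 1) cs) = 0 \<and> excess (take c cs) = 0)"
    and in_inside_iff: "in_inside (config_of cs) c \<longleftrightarrow>
      excess (take (c - 1) cs) \<noteq> 0 \<and> excess (take c cs) \<noteq> 0"
proof -
  \<comment> \<open>An arbitrary factorisation is pulled back to lists of columns; the forward
    implications start from such an unknown witness.\<close>
  have fac: "\<exists>css w ds. us = map config_of css \<and> u = config_of w \<and> vs = map config_of ds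
      \<and> ncols (cats us) = length (concat css) \<and> cs = concat (css @ w # ds)
      \<and> (\<forall>u\<in>set (css @ w # ds). prime_config (config_of u))"
    if pf: "prime_factors_of (config_of cs) (us @ u # vs)" for us u vs
  proof -
    obtain css' where css': "us @ u # vs = map config_of css'" "cs = concat css'"
        "\<forall>u\<in>set css'. prime_config (config_of u)"
      using prime_factors_config_of[OF pf] by metis
    obtain css ws where ws: "css' = css @ ws" "us = map config_of css"
        "u # vs = map config_of ws"
      using css'(1)[unfolded append_eq_map_conv] by (elim exE conjE) (rule that)
    obtain w ds where wds: "ws = w # ds" "u = config_of w" "vs = map config_of ds"
      using ws(3)[unfolded Cons_eq_map_conv] by (elim exE conjE) (rule that)
    show ?thesis
    proof (intro exI conjI)
      show "ncols (cats us) = length (concat css)" by (simp add: ws(2) cats_config_of)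
      show "cs = concat (css @ w # ds)" "\<forall>u\<in>set (css @ w # ds). prime_config (config_of u)"
        using css'(2,3) unfolding ws(1) wds(1) by simp_all
    qed (use ws wds in simp_all)
  qed
  \<comment> \<open>A fixed factorisation with its factor \<open>u\<close> around column
    \<open>c\<close> is the witness for both converse implications.\<close>
  obtain css' where "concat css' = cs" "\<forall>u\<in>set css'. prime_config (config_of u)"
    using exists_prime_factors[OF bal] by blast
  moreover obtain us u vs where "css' = us @ u # vs" "length (concat us) \<le> c - 1"
      "c - 1 < length (concat us) + length u"
  proof -
    have "c - 1 < length (concat css')" using c calculation(1) by auto
    from concat_split_at[OF this] show ?thesis using that by blast
  qed
  ultimately have u: "cs = concat (us @ u # vs)" "\<forall>u\<in>set (us @ u # vs). prime_config (config_of u)"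
      "length (concat us) < c" "c \<le> length (concat us) + length u"
    using c by auto
  have pf: "prime_factors_of (config_of cs) (map config_of us @ config_of u # map config_of vs)"
    using u cats_config_of[of "us @ u # vs"] by (auto simp: prime_factors_of_def)
  note bl = prime_is_block_iff[of u]
  show "in_block (config_of cs) c \<longleftrightarrow> \<not> (excess (take (c - 1) cs) = 0 \<and> excess (take c cs) = 0)"
  proof
    assume "in_block (config_of cs) c"
    then obtain us' u' vs' where f: "prime_factors_of (config_of cs) (us' @ u' # vs')"
        and b: "is_block u'" "ncols (cats us') + 1 \<le> c" "c \<le> ncols (cats us') + ncols u'"
      unfolding in_block_def by (elim exE conjE) (rule that)
    obtain css w ds where w: "u' = config_of w" "ncols (cats us') = length (concat css)"
        "cs = concat (css @ w # ds)" "\<forall>u\<in>set (css @ w # ds). prime_config (config_of u)"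
      using fac[OF f] by (elim exE conjE) (rule that)
    have "2 \<le> length w" using w(1,4) b(1) prime_is_block_iff[of w] by simp
    then show "\<not> (excess (take (c - 1) cs) = 0 \<and> excess (take c cs) = 0)"
      using factor_excess[OF w(4,3), of c] b(2,3) w(1,2) by auto
  next
    assume "\<not> (excess (take (c - 1) cs) = 0 \<and> excess (take c cs) = 0)"
    then have "\<not> (c = length (concat us) + 1 \<and> c = length (concat us) + length u)"
      unfolding factor_excess[OF u(2,1,3,4)] .
    then have "2 \<le> length u" using u(3,4) by linarith
    then have "is_block (config_of u)" using bl u(2) by simp
    then show "in_block (config_of cs) c"
      unfolding in_block_def using pf u(3,4)
      by (intro exI[of _ "map config_of us"] exI[of _ "config_of u"] exI[of _ "map config_of vs"])
        (simp add: cats_config_of)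
  qed
  show "in_inside (config_of cs) c \<longleftrightarrow> excess (take (c - 1) cs) \<noteq> 0 \<and> excess (take c cs) \<noteq> 0"
  proof
    assume "in_inside (config_of cs) c"
    then obtain us' u' vs' where f: "prime_factors_of (config_of cs) (us' @ u' # vs')"
        and "is_block u'" and b: "ncols (cats us') + 1 < c" "c < ncols (cats us') + ncols u'"
      unfolding in_inside_def by (elim exE conjE) (rule that)
    obtain css w ds where w: "u' = config_of w" "ncols (cats us') = length (concat css)"
        "cs = concat (css @ w # ds)" "\<forall>u\<in>set (css @ w # ds). prime_config (config_of u)"
      using fac[OF f] by (elim exE conjE) (rule that)
    show "excess (take (c - 1) cs) \<noteq> 0 \<and> excess (take c cs) \<noteq> 0"
      using factor_excess[OF w(4,3), of c] b w(1,2) by auto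
  next
    assume "excess (take (c - 1) cs) \<noteq> 0 \<and> excess (take c cs) \<noteq> 0"
    then have *: "length (concat us) + 1 < c" "c < length (concat us) + length u"
      using factor_excess[OF u(2,1,3,4)] u(3,4) by auto
    then have "is_block (config_of u)" using bl u(2) by simp
    then show "in_inside (config_of cs) c"
      unfolding in_inside_def using pf *
      by (intro exI[of _ "map config_of us"] exI[of _ "config_of u"] exI[of _ "map config_of vs"])
        (simp add: cats_config_of)
  qed
qed

lemma cell_config_of:
  "c \<in> {1..length cs} \<Longrightarrow> cell (fst (config_of cs)) c = fst (cs ! (c - 1))"
  "c \<in> {1..length cs} \<Longrightarrow> cell (snd (config_of cs)) c = snd (cs ! (c - 1))"
  by (auto simp: cell_def config_of_def)

lemma excess_take_step:
  assumes "c \<in> {1..length cs}"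
  shows "excess (take c cs) = excess (take (c - 1) cs) + col (cs ! (c - 1))"
proof -
  have "take (Suc (c - 1)) cs = take (c - 1) cs @ [cs ! (c - 1)]"
    using assms by (intro take_Suc_conv_app_nth) auto
  then show ?thesis using assms by simp
qed

section \<open>Labels\<close>

text \<open>A white bottom gives \<open>col \<le> 0\<close>, so from excess 0 the excess must stay
  0. Lying outside all blocks thus reduces to the excess on the left.\<close>

lemma z_label_iff:
  assumes bal: "balanced 0 cs"
  shows "z_label (config_of cs) c \<longleftrightarrow>
    c \<in> {1..length cs} \<and> snd (cs ! (c - 1)) = White \<and> excess (take (c - 1) cs) = 0"
proof (cases "c \<in> {1..length cs}")
  case True
  have "0 \<le> excess (take c cs)" using bal True by (simp add: balanced_iff)
  then have "snd (cs ! (c - 1)) = White \<Longrightarrow> excess (take (c - 1) cs) = 0 \<Longrightarrow> excess (take c cs) = 0"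
    using excess_take_step[OF True] by (cases "fst (cs ! (c - 1))") (auto simp: col_def)
  then show ?thesis
    unfolding z_label_def in_block_iff[OF bal True] using True cell_config_of(2)[OF True] by auto
qed (auto simp: z_label_def)

text \<open>A black bottom gives \<open>col \<ge> 0\<close>, so excess 0 after the column implies
  excess 0 before it. Lying outside the insides thus also reduces to the excess on the left, and the
  first column of a block qualifies.\<close>

lemma y_label_iff:
  assumes bal: "balanced 0 cs"
  shows "y_label (config_of cs) c \<longleftrightarrow>
    c \<in> {1..length cs} \<and> snd (cs ! (c - 1)) = Black \<and> excess (take (c - 1) cs) = 0 \<and>
      (\<forall>d<c. \<not> z_label (config_of cs) d)"
proof (cases "c \<in> {1..length cs}")
  case True
  have "\<forall>j\<le>length cs. 0 \<le> excess (take j cs)" using bal by (simp add: balanced_iff)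
  then have "0 \<le> excess (take (c - 1) cs)" using True by auto
  then have "snd (cs ! (c - 1)) = Black \<Longrightarrow> excess (take c cs) = 0 \<Longrightarrow> excess (take (c - 1) cs) = 0"
    using excess_take_step[OF True] by (cases "fst (cs ! (c - 1))") (auto simp: col_def)
  then show ?thesis
    unfolding y_label_def in_inside_iff[OF bal True] using True cell_config_of(2)[OF True] by auto
qed (auto simp: y_label_def)

text \<open>In \<open>zcount h cs\<close> and \<open>ycount h cs\<close>, \<open>h\<close> is the excess of the columns to the left of \<open>cs\<close>.\<close>

primrec zcount :: "int \<Rightarrow> column list \<Rightarrow> nat" where
  "zcount h [] = 0"
| "zcount h (c # cs) = (if h = 0 \<and> snd c = White then 1 else 0) + zcount (h + col c) cs"

primrec ycount :: "int \<Rightarrow> column list \<Rightarrow> nat" where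
  "ycount h [] = 0"
| "ycount h (c # cs) = (if h \<noteq> 0 then ycount (h + col c) cs
     else if snd c = White then 0 else 1 + ycount (h + col c) cs)"

section \<open>Label counts by recursion over the columns\<close>

lemma card_less_Suc_shift:
  "card {k. k < Suc n \<and> P k} = (if P 0 then 1 else 0) + card {k. k < n \<and> P (Suc k)}"
proof -
  have "{k. k < Suc n \<and> P k} = (if P 0 then {0} else {}) \<union> Suc ` {k. k < n \<and> P (Suc k)}"
    by (auto simp: image_iff less_Suc_eq_0_disj)
  moreover have "card ((if P 0 then {0} else {}) \<union> Suc ` {k. k < n \<and> P (Suc k)})
      = card (if P 0 then {0::nat} else {}) + card (Suc ` {k. k < n \<and> P (Suc k)})"
    by (rule card_Un_disjoint) auto
  ultimately show ?thesis by (simp add: card_image)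
qed

text \<open>Positions start at 0 here, and \<open>h\<close> stands for the excess of columns already
  stripped off, so that induction on the list applies.\<close>

definition z_at :: "int \<Rightarrow> column list \<Rightarrow> nat \<Rightarrow> bool" where
  "z_at h cs k \<longleftrightarrow> snd (cs ! k) = White \<and> h + excess (take k cs) = 0"

lemma z_at_simps [simp]:
  "z_at h (c # cs) 0 \<longleftrightarrow> h = 0 \<and> snd c = White"
  "z_at h (c # cs) (Suc k) \<longleftrightarrow> z_at (h + col c) cs k"
  unfolding z_at_def by (auto simp only: nth_Cons_0 nth_Cons_Suc take_0 take_Suc_Cons excess_simps
      add_0_right add.assoc)

lemma card_z_at: "card {k. k < length cs \<and> z_at h cs k} = zcount h cs"
proof (induction cs arbitrary: h)
  case (Cons c cs)
  show ?case
    unfolding length_Cons card_less_Suc_shift[of "length cs"] z_at_simps Cons.IH zcount.simps ..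
qed simp

text \<open>A z-label on the first column forbids all later y-labels, hence the value 0 with which
  \<open>ycount\<close> stops there.\<close>

lemma card_y_at:
  "card {k. k < length cs \<and> snd (cs ! k) = Black \<and> h + excess (take k cs) = 0 \<and> (\<forall>d<k. \<not> z_at h cs d)}
    = ycount h cs"
proof (induction cs arbitrary: h)
  case (Cons c cs)
  have "(\<forall>d<Suc k. \<not> z_at h (c # cs) d) \<longleftrightarrow>
      \<not> (h = 0 \<and> snd c = White) \<and> (\<forall>d<k. \<not> z_at (h + col c) cs d)" for k
    by (auto simp: All_less_Suc2)
  then show ?case
    using Cons.IH[of "h + col c"] by (cases "snd c") (auto simp: card_less_Suc_shift add.assoc)
qed simp

lemma n_z_config_of:
  assumes "balanced 0 cs"
  shows "n_z (config_of cs) = zcount 0 cs"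
proof -
  have "{c. z_label (config_of cs) c} = Suc ` {k. k < length cs \<and> z_at 0 cs k}"
  proof (intro equalityI subsetI)
    fix c assume "c \<in> {c. z_label (config_of cs) c}"
    then have z: "z_label (config_of cs) c" by simp
    then obtain k where k: "c = Suc k" using z_label_iff[OF assms] by (cases c) auto
    show "c \<in> Suc ` {k. k < length cs \<and> z_at 0 cs k}"
      using z by (auto simp: z_label_iff[OF assms] k z_at_def)
  qed (auto simp: z_label_iff[OF assms] z_at_def)
  then show ?thesis by (simp add: n_z_def card_image card_z_at)
qed

lemma n_y_config_of:
  assumes "balanced 0 cs"
  shows "n_y (config_of cs) = ycount 0 cs"
proof -
  \<comment> \<open>Columns are numbered from 1, so \<open>d = 0\<close> is never labelled and the
    range shifts by one.\<close>
  have z: "(\<forall>d<Suc k. \<not> z_label (config_of cs) d) \<longleftrightarrow> (\<forall>d<k. \<not> z_at 0 cs d)" if "k < length cs" for k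
    using that by (auto simp: z_label_iff[OF assms] z_at_def All_less_Suc2)
  have "{c. y_label (config_of cs) c} = Suc ` {k. k < length cs \<and> snd (cs ! k) = Black
      \<and> 0 + excess (take k cs) = 0 \<and> (\<forall>d<k. \<not> z_at 0 cs d)}"
  proof (intro equalityI subsetI)
    fix c assume "c \<in> {c. y_label (config_of cs) c}"
    then have y: "y_label (config_of cs) c" by simp
    then obtain k where k: "c = Suc k" using y_label_iff[OF assms] by (cases c) auto
    show "c \<in> Suc ` {k. k < length cs \<and> snd (cs ! k) = Black
      \<and> 0 + excess (take k cs) = 0 \<and> (\<forall>d<k. \<not> z_at 0 cs d)}"
      using y z[of k] by (auto simp: y_label_iff[OF assms] k)
  next
    fix c assume "c \<in> Suc ` {k. k < length cs \<and> snd (cs ! k) = Black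
      \<and> 0 + excess (take k cs) = 0 \<and> (\<forall>d<k. \<not> z_at 0 cs d)}"
    then obtain k where k: "c = Suc k" "k < length cs" "snd (cs ! k) = Black"
        "excess (take k cs) = 0" "\<forall>d<k. \<not> z_at 0 cs d" by auto
    then show "c \<in> {c. y_label (config_of cs) c}"
      using z[of k] by (simp add: y_label_iff[OF assms])
  qed
  then show ?thesis by (simp only: n_y_def card_image inj_Suc card_y_at)
qed

text \<open>The exponents in \<open>q\<close> are truncated differences; this bound and
  \<open>ycount_le\<close> allow \<open>Suc\<close> to be pulled out of them.\<close>

lemma zcount_le: "zcount h cs \<le> length cs"
proof (induction cs arbitrary: h)
  case (Cons c cs)
  show ?case using Cons.IH[of "h + col c"] by (cases "h = 0") auto
qed simp

lemma ycount_le: "ycount h cs \<le> length cs"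
proof (induction cs arbitrary: h)
  case (Cons c cs)
  show ?case using Cons.IH[of "h + col c"] by (cases "h = 0") auto
qed simp

section \<open>Deletions and moves\<close>

text \<open>\<open>grow R C i\<close>: deleting from \<open>C\<close> the particle pair that moves when wall \<open>i\<close> is chosen leaves \<open>R\<close>.
  In the rule \<open>WW\<close> the deleted pair is the top cell of one column and the bottom cell of the next.\<close>

inductive grow :: "column list \<Rightarrow> column list \<Rightarrow> nat \<Rightarrow> bool" where
  front: "grow C ((White, Black) # C) 0"
| WB: "grow (A @ (Black, x) # C) (A @ (Black, x) # (White, Black) # C) (length A + 1)"
| WW: "grow (A @ (White, x) # C) (A @ (Black, x) # (White, White) # C) (length A + 1)"
| rear: "grow A (A @ [(Black, White)]) (length A + 1)"

lemma grow_length: "grow R C i \<Longrightarrow> length C = Suc (length R)"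
  by (induction rule: grow.induct) auto

lemma balanced_WB:
  "balanced h (A @ (Black, x) # (White, Black) # C) = balanced h (A @ (Black, x) # C)"
  by (induction A arbitrary: h) simp_all

text \<open>Let \<open>k\<close> be the height before \<open>x\<close>. On the left the heights are
  \<open>k + 1 + val x\<close> and then \<open>k - 1 + val x\<close>; on the right only the second
  occurs, and its nonnegativity implies that of the first.\<close>

lemma balanced_WW:
  "balanced h (A @ (Black, x) # (White, White) # C) = balanced h (A @ (White, x) # C)"
proof (induction A arbitrary: h)
  case Nil
  then show ?case by (cases x) auto
qed simp

lemma balanced_back:
  "0 \<le> h \<Longrightarrow> balanced h (A @ [(Black, White)]) = balanced h A"
proof (induction A arbitrary: h)
  case (Cons a A)
  show ?case using Cons.IH[of "h + col a"] by auto
qed simp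

lemma grow_balanced: "grow R C i \<Longrightarrow> balanced 0 C = balanced 0 R"
  by (induction rule: grow.induct) (simp_all add: balanced_WB balanced_WW balanced_back)

lemma zcount_WB:
  "zcount h (A @ (Black, x) # (White, Black) # C) = zcount h (A @ (Black, x) # C)"
  by (induction A arbitrary: h) simp_all

text \<open>If the inserted column is met at height 0, then \<open>x\<close> is white and was met at
  height 0 as well, so it is a z-label and no y-label can follow.\<close>

lemma ycount_WB:
  "0 \<le> h \<Longrightarrow> balanced h (A @ (Black, x) # C) \<Longrightarrow>
    ycount h (A @ (Black, x) # (White, Black) # C) = ycount h (A @ (Black, x) # C)"
proof (induction A arbitrary: h)
  case Nil
  then show ?case by (cases x) auto
next
  case (Cons a A)
  show ?case using Cons.IH[of "h + col a"] Cons.prems by (cases "h = 0") auto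
qed

text \<open>Since \<open>(White, x)\<close> keeps the height nonnegative, the inserted white column
  is met at height at least 2 and carries no label. For the same reason a white \<open>x\<close> is
  met at positive height on both sides.\<close>

lemma zcount_WW:
  "0 \<le> h \<Longrightarrow> balanced h (A @ (White, x) # C) \<Longrightarrow>
    zcount h (A @ (Black, x) # (White, White) # C) = zcount h (A @ (White, x) # C)"
proof (induction A arbitrary: h)
  case Nil
  then show ?case by (cases x) auto
qed simp

lemma ycount_WW:
  "0 \<le> h \<Longrightarrow> balanced h (A @ (White, x) # C) \<Longrightarrow>
    ycount h (A @ (Black, x) # (White, White) # C) = ycount h (A @ (White, x) # C)"
proof (induction A arbitrary: h)
  case Nil
  then show ?case by (cases x) auto
next
  case (Cons a A)
  show ?case using Cons.IH[of "h + col a"] Cons.prems by (cases "h = 0") auto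
qed

text \<open>Balance returns the height to 0 before the last column, so its white bottom is a new
  z-label.\<close>

lemma zcount_back:
  "balanced h A \<Longrightarrow> zcount h (A @ [(Black, White)]) = Suc (zcount h A)"
  by (induction A arbitrary: h) simp_all

lemma ycount_back: "balanced h A \<Longrightarrow> ycount h (A @ [(Black, White)]) = ycount h A"
proof (induction A arbitrary: h)
  case (Cons a A)
  show ?case using Cons.IH[of "h + col a"] Cons.prems by (cases "h = 0") auto
qed simp

lemma q_config_of:
  "balanced 0 cs \<Longrightarrow> q \<alpha> \<beta> \<gamma> (config_of cs) =
    \<alpha> ^ (ycount 0 cs + zcount 0 cs) * \<beta> ^ (length cs - ycount 0 cs) * \<gamma> ^ (length cs - zcount 0 cs)"
  by (simp add: q_def n_y_config_of n_z_config_of)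

text \<open>The right-hand side does not depend on the wall: whatever the deletion changes in the labels is
  compensated by the rate of the wall.\<close>

lemma grow_weight:
  assumes "grow R C i" "balanced 0 C"
  shows "q \<alpha> \<beta> \<gamma> (config_of C) * rate (length C) \<alpha> \<beta> \<gamma> i = \<alpha> * \<beta> * \<gamma> * q \<alpha> \<beta> \<gamma> (config_of R)"
proof -
  have bal: "balanced 0 R" using assms grow_balanced by blast
  show ?thesis
    using assms bal
    using zcount_le[of 0 R] ycount_le[of 0 R]
    by cases (simp_all add: q_config_of rate_def zcount_WB ycount_WB zcount_WW ycount_WW
        zcount_back ycount_back Suc_diff_le)
qed

lemma grow_wall_le: "grow R C i \<Longrightarrow> i \<le> length C"
  by (induction rule: grow.induct) auto

section \<open>Moves of a pair from one wall to another\<close>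

abbreviation tops :: "column list \<Rightarrow> particle set" where
  "tops cs \<equiv> fst ` set cs"

definition black_end :: "column list \<Rightarrow> bool" where
  "black_end A \<longleftrightarrow> A = [] \<or> fst (last A) = Black"

text \<open>The left border counts as a black particle and the right border as a white one.\<close>

definition active :: "column list \<Rightarrow> nat \<Rightarrow> bool" where
  "active cs i \<longleftrightarrow> black_end (take i cs) \<and> (i < length cs \<longrightarrow> fst (cs ! i) = White)"

text \<open>Each rule displays source, target and both walls, so it can be used in either direction.
  \<open>R\<close> is the run jumped over; in the rules named \<open>_end\<close> it reaches the
  right border. In \<open>enter\<close>, \<open>enter_end\<close> and \<open>leave\<close> the
  bottom of the departing column is the one that completeness forces.\<close>

inductive move :: "column list \<Rightarrow> nat \<Rightarrow> column list \<Rightarrow> nat \<Rightarrow> bool" where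
  stay: "\<not> active cs i \<Longrightarrow> i \<le> length cs \<Longrightarrow> move cs i cs i"
| WB: "black_end A \<Longrightarrow> tops R \<subseteq> {White} \<Longrightarrow>
    move (A @ R @ (Black, x) # (White, Black) # C) (length A + length R + 1)
      (A @ (White, Black) # R @ (Black, x) # C) (length A)"
| leave: "black_end A \<Longrightarrow> tops R \<subseteq> {White} \<Longrightarrow>
    move (A @ R @ [(Black, White)]) (length A + length R + 1)
      (A @ (White, Black) # R) (length A)"
| WW: "tops R \<subseteq> {Black} \<Longrightarrow>
    move (A @ (Black, x) # (White, White) # R @ (White, y) # C) (length A + 1)
      (A @ (White, x) # R @ (Black, y) # (White, White) # C) (length A + length R + 2)"
| WW_end: "tops R \<subseteq> {Black} \<Longrightarrow>
    move (A @ (Black, x) # (White, White) # R) (length A + 1)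
      (A @ (White, x) # R @ [(Black, White)]) (length A + length R + 2)"
| enter: "tops R \<subseteq> {Black} \<Longrightarrow>
    move ((White, Black) # R @ (White, y) # C) 0
      (R @ (Black, y) # (White, White) # C) (length R + 1)"
| enter_end: "tops R \<subseteq> {Black} \<Longrightarrow>
    move ((White, Black) # R) 0 (R @ [(Black, White)]) (length R + 1)"

lemma black_end_cases:
  assumes "black_end A"
  obtains "A = []" | A' x where "A = A' @ [(Black, x)]"
proof (cases A rule: rev_cases)
  case (snoc A' c)
  then have "fst c = Black" using assms by (simp add: black_end_def)
  then show ?thesis using snoc that(2)[of A' "snd c"] by (cases c) simp
qed (use that in simp)

text \<open>This is \<open>front\<close> at the left border and \<open>WB\<close> behind a black
  top: the border acts as a black particle.\<close>

lemma grow_black_end: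
  assumes "black_end A"
  shows "grow (A @ C) (A @ (White, Black) # C) (length A)"
  using assms
proof (cases rule: black_end_cases)
  case 1
  then show ?thesis using grow.front by simp
next
  case (2 A' x)
  then show ?thesis using grow.WB[of A' x C] by simp
qed

text \<open>Removing the pair at its old or at its new place leaves the same list; only
  \<open>stay\<close> has no such intermediate list.\<close>

lemma move_grow:
  assumes "move C i D j"
  shows "(C = D \<and> i = j \<and> i \<le> length C) \<or> (\<exists>R. grow R C i \<and> grow R D j)"
  using assms
proof cases
  case stay
  then show ?thesis by simp
next
  case (WB A R x C')
  have "grow (A @ R @ (Black, x) # C') C i"
    using grow.WB[of "A @ R" x C'] WB by simp
  moreover have "grow (A @ R @ (Black, x) # C') D j"
    using grow_black_end[OF WB(5)] WB by simp
  ultimately show ?thesis by blast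
next
  case (leave A R)
  have "grow (A @ R) C i" using grow.rear[of "A @ R"] leave by simp
  moreover have "grow (A @ R) D j" using grow_black_end[OF leave(5)] leave by simp
  ultimately show ?thesis by blast
next
  case (WW R A x y C')
  have "grow (A @ (White, x) # R @ (White, y) # C') C i"
    using grow.WW[of A x] WW by simp
  moreover have "grow (A @ (White, x) # R @ (White, y) # C') D j"
    using grow.WW[of "A @ (White, x) # R" y C'] WW by simp
  ultimately show ?thesis by blast
next
  case (WW_end R A x)
  have "grow (A @ (White, x) # R) C i" using grow.WW[of A x] WW_end by simp
  moreover have "grow (A @ (White, x) # R) D j"
    using grow.rear[of "A @ (White, x) # R"] WW_end by simp
  ultimately show ?thesis by blast
next
  case (enter R y C')
  have "grow (R @ (White, y) # C') C i" using grow.front enter by simp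
  moreover have "grow (R @ (White, y) # C') D j" using grow.WW[of R y C'] enter by simp
  ultimately show ?thesis by blast
next
  case (enter_end R)
  have "grow R C i" using grow.front enter_end by simp
  moreover have "grow R D j" using grow.rear[of R] enter_end by simp
  ultimately show ?thesis by blast
qed

text \<open>Balance is assumed at one end only, so that the lemma serves both for a given source and
  for a given target.\<close>

lemma move_invariants:
  assumes "move C i D j" "balanced 0 C \<or> balanced 0 D"
  shows "balanced 0 C" "balanced 0 D" "length D = length C" "i \<le> length C" "j \<le> length D"
    and "q \<alpha> \<beta> \<gamma> (config_of D) * rate (length D) \<alpha> \<beta> \<gamma> j
       = q \<alpha> \<beta> \<gamma> (config_of C) * rate (length C) \<alpha> \<beta> \<gamma> i"
proof -
  have *: "balanced 0 C \<and> balanced 0 D \<and> length D = length C \<and> i \<le> length C \<and> j \<le> length D \<and>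
    q \<alpha> \<beta> \<gamma> (config_of D) * rate (length D) \<alpha> \<beta> \<gamma> j
       = q \<alpha> \<beta> \<gamma> (config_of C) * rate (length C) \<alpha> \<beta> \<gamma> i" for \<alpha> \<beta> \<gamma>
    using move_grow[OF assms(1)]
  proof
    assume "\<exists>R. grow R C i \<and> grow R D j"
    then obtain R where R: "grow R C i" "grow R D j" by blast
    have "balanced 0 C" "balanced 0 D"
      using grow_balanced[OF R(1)] grow_balanced[OF R(2)] assms(2) by auto
    then show ?thesis
      using R grow_weight[OF R(1)] grow_weight[OF R(2)] grow_length[OF R(1)] grow_length[OF R(2)]
        grow_wall_le[OF R(1)] grow_wall_le[OF R(2)] by simp
  qed (use assms(2) in auto)
  show "balanced 0 C" "balanced 0 D" "length D = length C" "i \<le> length C" "j \<le> length D"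
    "q \<alpha> \<beta> \<gamma> (config_of D) * rate (length D) \<alpha> \<beta> \<gamma> j
       = q \<alpha> \<beta> \<gamma> (config_of C) * rate (length C) \<alpha> \<beta> \<gamma> i"
    using * by blast+
qed

text \<open>This split and \<open>split_first_White\<close> find where a pair lands;
  \<open>split_last_White\<close> and \<open>split_first_Black\<close> find where it came
  from.\<close>

lemma split_last_Black:
  obtains A R where "cs = A @ R" "black_end A" "tops R \<subseteq> {White}"
proof -
  have "\<exists>A R. cs = A @ R \<and> black_end A \<and> tops R \<subseteq> {White}"
  proof (induction cs rule: rev_induct)
    case Nil
    then show ?case by (simp add: black_end_def)
  next
    case (snoc c cs)
    then obtain A R where AR: "cs = A @ R" "black_end A" "tops R \<subseteq> {White}" by blast
    show ?case
    proof (cases "fst c")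
      case Black
      then show ?thesis by (intro exI[of _ "cs @ [c]"] exI[of _ "[]"]) (simp add: black_end_def)
    next
      case White
      then show ?thesis using AR by (intro exI[of _ A] exI[of _ "R @ [c]"]) simp
    qed
  qed
  then show ?thesis using that by blast
qed

lemma split_first_White:
  obtains "tops cs \<subseteq> {Black}" | R y C where "cs = R @ (White, y) # C" "tops R \<subseteq> {Black}"
proof (cases "White \<in> tops cs")
  case True
  then obtain c where "c \<in> set cs" "fst c = White" by auto
  then obtain R c C where "cs = R @ c # C" "fst c = White" "\<forall>d\<in>set R. fst d \<noteq> White"
    using split_list_first_prop[of cs "\<lambda>c. fst c = White"] by metis
  then show ?thesis using that(2)[of R "snd c" C] by (cases c) (auto intro: particle.exhaust)
next
  case False
  then have "tops cs \<subseteq> {Black}" by (metis insertI1 particle.exhaust subsetI)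
  then show ?thesis using that by blast
qed

lemma split_last_White:
  obtains "tops cs \<subseteq> {Black}" | A x R where "cs = A @ (White, x) # R" "tops R \<subseteq> {Black}"
proof (cases "White \<in> tops cs")
  case True
  then obtain c where "c \<in> set cs" "fst c = White" by auto
  then obtain A c R where "cs = A @ c # R" "fst c = White" "\<forall>d\<in>set R. fst d \<noteq> White"
    using split_list_last_prop[of cs "\<lambda>c. fst c = White"] by metis
  then show ?thesis using that(2)[of A "snd c" R] by (cases c) (auto intro: particle.exhaust)
next
  case False
  then have "tops cs \<subseteq> {Black}" by (metis insertI1 particle.exhaust subsetI)
  then show ?thesis using that by blast
qed

lemma split_first_Black:
  obtains "tops cs \<subseteq> {White}" | R x C where "cs = R @ (Black, x) # C" "tops R \<subseteq> {White}"
proof (cases "Black \<in> tops cs")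
  case True
  then obtain c where "c \<in> set cs" "fst c = Black" by auto
  then obtain R c C where "cs = R @ c # C" "fst c = Black" "\<forall>d\<in>set R. fst d \<noteq> Black"
    using split_list_first_prop[of cs "\<lambda>c. fst c = Black"] by metis
  then show ?thesis using that(2)[of R "snd c" C] by (cases c) (auto intro: particle.exhaust)
next
  case False
  then have "tops cs \<subseteq> {White}" by (metis insertI1 particle.exhaust subsetI)
  then show ?thesis using that by blast
qed

text \<open>The height is nonnegative before the last column and 0 after it, so a black top needs a
  white bottom.\<close>

lemma last_column:
  assumes "balanced h (A @ [c])" "0 \<le> h" "fst c = Black"
  shows "c = (Black, White)"
  using assms
proof (induction A arbitrary: h)
  case Nil
  then show ?case by (cases c; cases "snd c") auto
next
  case (Cons a A)
  show ?case using Cons.IH[of "h + col a"] Cons.prems by simp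
qed

lemma first_column:
  assumes "balanced 0 (c # cs)" "fst c = White"
  shows "c = (White, Black)"
  using assms by (cases c; cases "snd c") auto

text \<open>These are the pairs inserted by the \<open>grow\<close> rules, with \<open>front\<close>
  absorbed into \<open>WB\<close> by an empty \<open>A\<close>. They classify sources and targets of
  moves alike.\<close>

lemma active_cases:
  assumes "balanced 0 cs" "cs \<noteq> []" "active cs i" "i \<le> length cs"
  obtains (WB) A C where "cs = A @ (White, Black) # C" "i = length A" "black_end A"
    | (WW) A x C where "cs = A @ (Black, x) # (White, White) # C" "i = Suc (length A)"
    | (rear) A where "cs = A @ [(Black, White)]" "i = Suc (length A)"
proof (cases "i = length cs")
  case True
  obtain A c where c: "cs = A @ [c]" using assms(2) by (cases cs rule: rev_cases) auto
  then have "fst c = Black" using assms(3) True by (simp add: active_def black_end_def)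
  then have "c = (Black, White)" using last_column[of 0 A c] assms(1) c by simp
  then show ?thesis using rear[of A] c True by simp
next
  case False
  define A where "A = take i cs"
  obtain c C where cC: "drop i cs = c # C" using False assms(4) by (cases "drop i cs") auto
  have cs: "cs = A @ c # C" using cC A_def by (metis append_take_drop_id)
  have i: "i = length A" using A_def assms(4) by simp
  have bA: "black_end A" and cW: "fst c = White"
    using assms(3) unfolding active_def by (simp_all add: cs i)
  show ?thesis
  proof (cases "snd c")
    case Black
    then have "c = (White, Black)" using cW by (cases c) simp
    then show ?thesis using WB[of A C] cs i bA by simp
  next
    case White
    then have c: "c = (White, White)" using cW by (cases c) simp
    show ?thesis
      using bA
    proof (cases rule: black_end_cases)
      \<comment> \<open>At the left border a column of two white particles would make the excess
        negative.\<close>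
      case 1
      then show ?thesis using assms(1) cs c by simp
    next
      case (2 A' x)
      then show ?thesis using WW[of A' x C] cs c i by simp
    qed
  qed
qed

lemma move_from:
  assumes "balanced 0 cs" "cs \<noteq> []" "i \<le> length cs"
  shows "\<exists>ds j. move cs i ds j"
proof (cases "active cs i")
  case True
  from assms(1,2) True assms(3) show ?thesis
  proof (cases rule: active_cases)
    case (WB A C)
    show ?thesis
      using WB(3)
    proof (cases rule: black_end_cases)
      case 1
      show ?thesis
        using split_first_White[of C]
      proof cases
        case 1
        then show ?thesis using move.enter_end[of C] WB \<open>A = []\<close> by auto
      next
        case (2 R y C')
        then show ?thesis using move.enter[of R y C'] WB \<open>A = []\<close> by auto
      qed
    next
      case (2 A' x)
      obtain A'' R where "A' = A'' @ R" "black_end A''" "tops R \<subseteq> {White}"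
        by (rule split_last_Black)
      then show ?thesis using move.WB[of A'' R x C] WB 2 by auto
    qed
  next
    case (WW A x C)
    show ?thesis
      using split_first_White[of C]
    proof cases
      case 1
      then show ?thesis using move.WW_end[of C A x] WW by auto
    next
      case (2 R y C')
      then show ?thesis using move.WW[of R A x y C'] WW by auto
    qed
  next
    case (rear A)
    obtain A' R where "A = A' @ R" "black_end A'" "tops R \<subseteq> {White}"
      by (rule split_last_Black)
    then show ?thesis using move.leave[of A' R] rear by auto
  qed
qed (use move.stay assms(3) in blast)

text \<open>A \<open>(White, Black)\<close> column came from behind the next black top on its right,
  or from the right border if there is none. In the other two shapes the pair came from the last
  white top on the left, or from wall 0 if there is none.\<close>

lemma move_onto:
  assumes "balanced 0 cs" "cs \<noteq> []" "j \<le> length cs"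
  shows "\<exists>ds i. move ds i cs j"
proof (cases "active cs j")
  case True
  from assms(1,2) True assms(3) show ?thesis
  proof (cases rule: active_cases)
    case (WB A C)
    show ?thesis
      using split_first_Black[of C]
    proof cases
      case 1
      then show ?thesis using move.leave[of A C] WB by auto
    next
      case (2 R x C')
      then show ?thesis using move.WB[of A R x C'] WB by auto
    qed
  next
    case (WW A y C)
    show ?thesis
      using split_last_White[of A]
    proof cases
      case 1
      then show ?thesis using move.enter[of A y C] WW by auto
    next
      case (2 A' x R)
      then show ?thesis using move.WW[of R A' x y C] WW by auto
    qed
  next
    case (rear A)
    show ?thesis
      using split_last_White[of A]
    proof cases
      case 1
      then show ?thesis using move.enter_end[of A] rear by auto
    next
      case (2 A' x R)
      then show ?thesis using move.WW_end[of R A' x] rear by auto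
    qed
  qed
qed (use move.stay assms(3) in blast)

section \<open>The moves compute the map \<open>T\<close>\<close>

lemma cell_append:
  "0 < k \<Longrightarrow> k \<le> length r \<Longrightarrow> cell (r @ s) k = cell r k"
  "length r < k \<Longrightarrow> cell (r @ s) k = cell s (k - length r)"
  by (auto simp: cell_def nth_append)

lemma cell_Cons [simp]: "cell (x # r) (Suc 0) = x"
  by (simp add: cell_def)

lemma cell_at: "cell (r @ x # s) (Suc (length r)) = x"
  by (simp add: cell_def)

lemma delete_cell_at: "delete_cell (Suc (length r)) (r @ x # s) = r @ s"
  by (simp add: delete_cell_def)

lemma insert_cell_at: "insert_cell (Suc (length r)) x (r @ s) = r @ x # s"
  by (simp add: insert_cell_def)

lemma cell_in_set: "0 < k \<Longrightarrow> k \<le> length r \<Longrightarrow> cell r k \<in> set r"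
  by (simp add: cell_def)

text \<open>The white run \<open>R\<close> is maximal to the left, because a black top or the border
  precedes it.\<close>

lemma left_wall_eq:
  assumes "A = [] \<or> last A = Black" "set R \<subseteq> {White}"
  shows "left_wall (A @ R @ S) (length A + length R + 1) = length A"
proof -
  let ?J = "{j \<in> {0..length A + length R}. \<forall>k\<in>{j + 1..length A + length R}. cell (A @ R @ S) k = White}"
  have R: "cell (A @ R @ S) k = White" if "length A < k" "k \<le> length A + length R" for k
  proof -
    have "cell R (k - length A) \<in> set R" using that by (intro cell_in_set) linarith+
    then show ?thesis using assms(2) that by (auto simp: cell_append)
  qed
  have "Min ?J = length A"
  proof (rule Min_eqI)
    fix j assume j: "j \<in> ?J"
    show "length A \<le> j"
    proof (rule ccontr)
      assume "\<not> length A \<le> j"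
      \<comment> \<open>As \<open>j\<close> is smaller than \<open>length A\<close>, the cell
        numbered \<open>length A\<close> belongs to the tested range.\<close>
      then have "cell (A @ R @ S) (length A) = White" "A \<noteq> []" using j by auto
      moreover from this(2) have "cell (A @ R @ S) (length A) = last A"
        by (simp add: cell_append last_conv_nth) (simp add: cell_def)
      ultimately show False using assms(1) by simp
    qed
  qed (use R in auto)
  then show ?thesis by (simp add: left_wall_def)
qed

text \<open>\<open>A\<close> holds the cells up to \<open>i + 1\<close>, so \<open>R\<close> begins
  at cell \<open>i + 2\<close>, where the definition starts testing for black.\<close>

lemma right_wall_eq:
  assumes "S = [] \<or> hd S = White" "set R \<subseteq> {Black}" "length A = Suc i"
  shows "right_wall (A @ R @ S) i = length A + length R"
proof -
  let ?J = "{j \<in> {i + 1..length (A @ R @ S)}. \<forall>k\<in>{i + 2..j}. cell (A @ R @ S) k = Black}"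
  have R: "cell (A @ R @ S) k = Black" if "length A < k" "k \<le> length A + length R" for k
  proof -
    have "cell R (k - length A) \<in> set R" using that by (intro cell_in_set) linarith+
    then show ?thesis using assms(2) that by (auto simp: cell_append)
  qed
  have "Max ?J = length A + length R"
  proof (rule Max_eqI)
    fix j assume j: "j \<in> ?J"
    show "j \<le> length A + length R"
    proof (rule ccontr)
      assume *: "\<not> j \<le> length A + length R"
      then have "cell (A @ R @ S) (length A + length R + 1) = Black" "S \<noteq> []"
        using j assms(3) by auto
      moreover from this(2) have "cell (A @ R @ S) (length A + length R + 1) = hd S"
        by (simp add: cell_append) (simp add: cell_def hd_conv_nth)
      ultimately show False using assms(1) by simp
    qed
  qed (use R assms(3) in auto)
  then show ?thesis by (simp add: right_wall_def)
qed

text \<open>The wall at which the moved pair is reinserted; together with \<open>T\<close> it gives a bijection of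
  configurations with a distinguished wall.\<close>

definition landing :: "config \<Rightarrow> nat \<Rightarrow> nat" where
  "landing \<omega> i = (case \<omega> of (t, b) \<Rightarrow>
     let n = length t in
     if 1 \<le> i \<and> i \<le> n - 1 \<and> cell t i = Black \<and> cell t (i + 1) = White \<and> cell b (i + 1) = Black
     then left_wall t i
     else if 1 \<le> i \<and> i \<le> n - 1 \<and> cell t i = Black \<and> cell t (i + 1) = White \<and> cell b (i + 1) = White
     then right_wall t i
     else if i = 0 \<and> cell t 1 = White then right_wall t i
     else if i = n \<and> cell t n = Black then left_wall t i
     else i)"

lemma T_left:
  assumes "0 < i" "i < length t" "cell t i = Black" "cell t (Suc i) = White" "cell b (Suc i) = Black"
  shows "T (t, b) i = (insert_cell (left_wall t i + 1) White (delete_cell (Suc i) t),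
           insert_cell (left_wall t i + 1) Black (delete_cell (Suc i) b))"
    and "landing (t, b) i = left_wall t i"
  using assms by (auto simp: T_def landing_def Let_def)

lemma T_right:
  assumes "0 < i" "i < length t" "cell t i = Black" "cell t (Suc i) = White" "cell b (Suc i) = White"
  shows "T (t, b) i = (insert_cell (right_wall t i) Black (delete_cell i t),
           insert_cell (if right_wall t i < length t then right_wall t i + 1 else length t) White
             (delete_cell (Suc i) b))"
    and "landing (t, b) i = right_wall t i"
  using assms by (auto simp: T_def landing_def Let_def)

lemma T_enter:
  assumes "cell t 1 = White"
  shows "T (t, b) 0 = (insert_cell (right_wall t 0) Black (delete_cell 1 t),
           insert_cell (if right_wall t 0 < length t then right_wall t 0 + 1 else length t) White
             (delete_cell 1 b))"
    and "landing (t, b) 0 = right_wall t 0"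
  using assms by (auto simp: T_def landing_def Let_def)

lemma T_leave:
  assumes "0 < length t" "cell t (length t) = Black"
  shows "T (t, b) (length t) = (insert_cell (left_wall t (length t) + 1) White (delete_cell (length t) t),
           insert_cell (left_wall t (length t) + 1) Black (delete_cell (length t) b))"
    and "landing (t, b) (length t) = left_wall t (length t)"
  using assms by (auto simp: T_def landing_def Let_def)

lemma config_of_cells:
  assumes "config_of cs = (t, b)" "i < length cs"
  shows "cell t (Suc i) = fst (cs ! i)" "cell b (Suc i) = snd (cs ! i)"
  using assms by (auto simp: config_of_def cell_def)

text \<open>With the borders read as virtual particles, an active wall is what (a'), (a''), (b) and
  (c) have in common; any other wall falls under (d).\<close>

lemma inactive_T:
  assumes "\<not> active cs i" "i \<le> length cs" "cs \<noteq> []"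
  shows "T (config_of cs) i = config_of cs" "landing (config_of cs) i = i"
proof -
  obtain t b where tb: "config_of cs = (t, b)" by fastforce
  then have len: "length t = length cs" by (auto simp: config_of_def)
  have be: "black_end (take i cs) \<longleftrightarrow> i = 0 \<or> cell t i = Black"
  proof (cases i)
    case 0
    then show ?thesis by (simp add: black_end_def)
  next
    case (Suc k)
    then have "fst (last (take i cs)) = cell t i" "take i cs \<noteq> []"
      using config_of_cells[OF tb, of k] assms(2) by (auto simp: take_Suc_conv_app_nth)
    then show ?thesis using Suc by (simp add: black_end_def)
  qed
  have wh: "fst (cs ! i) = White \<longleftrightarrow> cell t (Suc i) = White" if "i < length cs"
    using config_of_cells[OF tb that] by simp
  have *: "\<not> ((i = 0 \<or> cell t i = Black) \<and> (i < length cs \<longrightarrow> cell t (Suc i) = White))"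
    using assms(1) be wh unfolding active_def by blast
  have "\<not> (1 \<le> i \<and> i \<le> length t - 1 \<and> cell t i = Black \<and> cell t (i + 1) = White)"
       "\<not> (i = 0 \<and> cell t 1 = White)" "\<not> (i = length t \<and> cell t (length t) = Black)"
    using * assms(3) by (auto simp: len)
  then show "T (config_of cs) i = config_of cs" "landing (config_of cs) i = i"
    unfolding tb T_def landing_def Let_def prod.case by (simp_all only: if_False) auto
qed

text \<open>In the \<open>WW\<close> case top cell \<open>i\<close> and bottom cell
  \<open>i + 1\<close> disappear: \<open>x\<close> comes under the next white top, the columns of
  \<open>R\<close> shift as whole columns, and the insertions at cells \<open>j2\<close> and
  \<open>j2 + 1\<close> put a black over \<open>y\<close> and a white below in the following
  column.\<close>

lemma move_T:
  assumes "move C i D j" "C \<noteq> []"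
  shows "T (config_of C) i = config_of D \<and> landing (config_of C) i = j"
  using assms(1)
proof cases
  case stay
  then show ?thesis using inactive_T assms(2) by blast
next
  case (WB A R x C')
  let ?A = "map fst A" and ?R = "map fst R" and ?C = "map fst C'"
  let ?A' = "map snd A" and ?R' = "map snd R" and ?C' = "map snd C'"
  let ?t = "?A @ ?R @ Black # White # ?C" and ?b = "?A' @ ?R' @ x # Black # ?C'"
  have c: "config_of C = (?t, ?b)" "config_of D = (?A @ White # ?R @ Black # ?C, ?A' @ Black # ?R' @ x # ?C')"
    by (simp_all add: WB config_of_def)
  have w: "left_wall ?t i = length A"
    using left_wall_eq[of ?A ?R "Black # White # ?C"] WB by (cases "A = []") (auto simp: black_end_def last_map)
  have "0 < i" "i < length ?t" "cell ?t i = Black" "cell ?t (Suc i) = White" "cell ?b (Suc i) = Black"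
    using cell_at[of "?A @ ?R" Black] cell_at[of "?A @ ?R @ [Black]" White] cell_at[of "?A' @ ?R' @ [x]" Black]
    by (simp_all add: WB(2))
  from T_left[OF this] show ?thesis
    unfolding c w
    using delete_cell_at[of "?A @ ?R @ [Black]" White ?C] delete_cell_at[of "?A' @ ?R' @ [x]" Black ?C']
      insert_cell_at[of ?A White "?R @ Black # ?C"] insert_cell_at[of ?A' Black "?R' @ x # ?C'"]
    by (simp add: WB(2,4))
next
  case (leave A R)
  let ?A = "map fst A" and ?R = "map fst R"
  let ?A' = "map snd A" and ?R' = "map snd R"
  let ?t = "?A @ ?R @ [Black]" and ?b = "?A' @ ?R' @ [White]"
  have c: "config_of C = (?t, ?b)" "config_of D = (?A @ White # ?R, ?A' @ Black # ?R')"
    by (simp_all add: leave config_of_def)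
  have i: "i = length ?t" by (simp add: leave)
  have w: "left_wall ?t i = length A"
    using left_wall_eq[of ?A ?R "[Black]"] leave by (cases "A = []") (auto simp: black_end_def last_map)
  have "0 < length ?t" "cell ?t (length ?t) = Black"
    using cell_at[of "?A @ ?R" Black] by simp_all
  from T_leave[OF this, folded i] show ?thesis
    unfolding c w
    using delete_cell_at[of "?A @ ?R" Black "[]"] delete_cell_at[of "?A' @ ?R'" White "[]"]
      insert_cell_at[of ?A White ?R] insert_cell_at[of ?A' Black ?R']
    by (simp add: leave(2,4))
next
  case (WW R A x y C')
  let ?A = "map fst A" and ?R = "map fst R" and ?C = "map fst C'"
  let ?A' = "map snd A" and ?R' = "map snd R" and ?C' = "map snd C'"
  let ?t = "?A @ Black # White # ?R @ White # ?C" and ?b = "?A' @ x # White # ?R' @ y # ?C'"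
  have c: "config_of C = (?t, ?b)"
      "config_of D = (?A @ White # ?R @ Black # White # ?C, ?A' @ x # ?R' @ y # White # ?C')"
    by (simp_all add: WW config_of_def)
  have w: "right_wall ?t i = Suc (Suc (length A + length R))"
    using right_wall_eq[of "White # ?C" ?R "?A @ [Black, White]" i] WW by auto
  have "0 < i" "i < length ?t" "cell ?t i = Black" "cell ?t (Suc i) = White" "cell ?b (Suc i) = White"
    using cell_at[of ?A Black] cell_at[of "?A @ [Black]" White] cell_at[of "?A' @ [x]" White]
    by (simp_all add: WW(2))
  from T_right[OF this] show ?thesis
    unfolding c w
    using delete_cell_at[of ?A Black "White # ?R @ White # ?C"]
      delete_cell_at[of "?A' @ [x]" White "?R' @ y # ?C'"]
      insert_cell_at[of "?A @ White # ?R" Black "White # ?C"]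
      insert_cell_at[of "?A' @ x # ?R' @ [y]" White ?C']
    by (simp add: WW(2,4))
next
  case (WW_end R A x)
  let ?A = "map fst A" and ?R = "map fst R"
  let ?A' = "map snd A" and ?R' = "map snd R"
  let ?t = "?A @ Black # White # ?R" and ?b = "?A' @ x # White # ?R'"
  have c: "config_of C = (?t, ?b)"
      "config_of D = (?A @ White # ?R @ [Black], ?A' @ x # ?R' @ [White])"
    by (simp_all add: WW_end config_of_def)
  \<comment> \<open>This value is the length of the row, so the white bottom goes into the last cell
    and not one further.\<close>
  have w: "right_wall ?t i = Suc (Suc (length A + length R))"
    using right_wall_eq[of "[]" ?R "?A @ [Black, White]" i] WW_end by auto
  have "0 < i" "i < length ?t" "cell ?t i = Black" "cell ?t (Suc i) = White" "cell ?b (Suc i) = White"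
    using cell_at[of ?A Black] cell_at[of "?A @ [Black]" White] cell_at[of "?A' @ [x]" White]
    by (simp_all add: WW_end(2))
  from T_right[OF this] show ?thesis
    unfolding c w
    using delete_cell_at[of ?A Black "White # ?R"]
      delete_cell_at[of "?A' @ [x]" White "?R'"]
      insert_cell_at[of "?A @ White # ?R" Black "[]"]
      insert_cell_at[of "?A' @ x # ?R'" White "[]"]
    by (simp add: WW_end(2,4))
next
  case (enter R y C')
  let ?R = "map fst R" and ?C = "map fst C'"
  let ?R' = "map snd R" and ?C' = "map snd C'"
  let ?t = "White # ?R @ White # ?C" and ?b = "Black # ?R' @ y # ?C'"
  have c: "config_of C = (?t, ?b)"
      "config_of D = (?R @ Black # White # ?C, ?R' @ y # White # ?C')"
    by (simp_all add: enter config_of_def)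
  have w: "right_wall ?t 0 = Suc (length R)"
    using right_wall_eq[of "White # ?C" ?R "[White]" 0] enter by auto
  have "cell ?t 1 = White" by simp
  from T_enter[OF this, of ?b] show ?thesis
    unfolding c w enter(2)
    using delete_cell_at[of "[]" White "?R @ White # ?C"]
      delete_cell_at[of "[]" Black "?R' @ y # ?C'"]
      insert_cell_at[of ?R Black "White # ?C"]
      insert_cell_at[of "?R' @ [y]" White ?C']
    by (simp add: enter(4))
next
  case (enter_end R)
  let ?R = "map fst R" and ?R' = "map snd R"
  let ?t = "White # ?R" and ?b = "Black # ?R'"
  have c: "config_of C = (?t, ?b)" "config_of D = (?R @ [Black], ?R' @ [White])"
    by (simp_all add: enter_end config_of_def)
  have w: "right_wall ?t 0 = Suc (length R)"
    using right_wall_eq[of "[]" ?R "[White]" 0] enter_end by auto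
  have "cell ?t 1 = White" by simp
  from T_enter[OF this, of ?b] show ?thesis
    unfolding c w enter_end(2)
    using delete_cell_at[of "[]" White ?R] delete_cell_at[of "[]" Black ?R']
      insert_cell_at[of ?R Black "[]"] insert_cell_at[of ?R' White "[]"]
    by (simp add: enter_end(4))
qed

section \<open>Global balance\<close>

lemma finite_complete_configs: "finite (complete_configs n)"
proof -
  have "finite {t :: particle list. set t \<subseteq> {Black, White} \<and> length t = n}"
    by (rule finite_lists_length_eq) simp
  moreover have "set t \<subseteq> {Black, White}" for t
  proof
    show "x \<in> {Black, White}" for x by (cases x) simp_all
  qed
  ultimately have "finite {t :: particle list. length t = n}" by simp
  then have "finite ({t :: particle list. length t = n} \<times> {t :: particle list. length t = n})"
    by (intro finite_cartesian_product)
  then show ?thesis by (rule finite_subset[rotated]) (auto simp: complete_configs_def)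
qed

lemma T_move:
  assumes "n \<ge> 1" "\<omega> \<in> complete_configs n" "i \<le> n"
  obtains C D j where "\<omega> = config_of C" "move C i D j" "T \<omega> i = config_of D" "landing \<omega> i = j"
    "balanced 0 C" "length C = n" "balanced 0 D" "length D = n" "j \<le> n"
proof -
  obtain C where C: "\<omega> = config_of C" "balanced 0 C" "length C = n"
    using assms(2) by (auto simp: complete_configs_eq)
  moreover have "C \<noteq> []" using C(3) assms(1) by auto
  ultimately obtain D j where m: "move C i D j" using move_from[of C i] assms(3) by blast
  have "T \<omega> i = config_of D" "landing \<omega> i = j" using move_T[OF m \<open>C \<noteq> []\<close>] C(1) by simp_all
  then show ?thesis
    using that[OF C(1) m] move_invariants(2-5)[OF m disjI1[OF C(2)]] C by simp
qed

lemma T_complete: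
  "n \<ge> 1 \<Longrightarrow> \<omega> \<in> complete_configs n \<Longrightarrow> i \<le> n \<Longrightarrow> T \<omega> i \<in> complete_configs n"
  by (erule (2) T_move) simp

lemma global_balance:
  assumes n: "n \<ge> 1" and \<omega>': "\<omega>' \<in> complete_configs n"
  shows "(\<Sum>\<omega>\<in>complete_configs n. \<Sum>i\<in>{0..n}.
      q \<alpha> \<beta> \<gamma> \<omega> * rate n \<alpha> \<beta> \<gamma> i * of_bool (T \<omega> i = \<omega>'))
    = q \<alpha> \<beta> \<gamma> \<omega>' * (\<Sum>i\<in>{0..n}. rate n \<alpha> \<beta> \<gamma> i)"
proof -
  let ?S = "complete_configs n \<times> {0..n}"
  define F where "F = (\<lambda>(\<omega>, i). (T \<omega> i, landing \<omega> i))"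
  define w where "w = (\<lambda>(\<omega>, i). q \<alpha> \<beta> \<gamma> \<omega> * rate n \<alpha> \<beta> \<gamma> i)"
  have fin: "finite ?S" by (intro finite_cartesian_product finite_complete_configs) simp
  have into: "F s \<in> ?S \<and> w (F s) = w s" if "s \<in> ?S" for s
  proof -
    obtain \<omega> i where s1: "s = (\<omega>, i)" by (rule prod.exhaust)
    then have s: "s = (\<omega>, i)" "\<omega> \<in> complete_configs n" "i \<le> n" using that by simp_all
    obtain C D j where m: "\<omega> = config_of C" "move C i D j" "T \<omega> i = config_of D" "landing \<omega> i = j"
        "balanced 0 C" "length C = n" "balanced 0 D" "length D = n" "j \<le> n"
      by (rule T_move[OF n s(2,3)])
    show ?thesis
      using move_invariants(6)[OF m(2), of \<alpha> \<beta> \<gamma>] m by (simp add: F_def w_def s(1))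
  qed
  have onto: "?S \<subseteq> F ` ?S"
  proof
    fix s assume "s \<in> ?S"
    then obtain D j where s: "s = (config_of D, j)" "balanced 0 D" "length D = n" "j \<le> n"
      by (auto simp: complete_configs_eq)
    moreover have "D \<noteq> []" using s(3) n by auto
    ultimately obtain C i where m: "move C i D j" using move_onto[of D j] by blast
    note inv = move_invariants[OF m disjI2[OF s(2)]]
    have "C \<noteq> []" using inv(3) s(3) n by auto
    then have "F (config_of C, i) = s"
      using move_T[OF m] s(1) by (simp add: F_def)
    moreover have "(config_of C, i) \<in> ?S" using inv s by auto
    ultimately show "s \<in> F ` ?S" by blast
  qed
  have img: "F ` ?S = ?S" using into onto by blast
  then have "inj_on F ?S" by (intro eq_card_imp_inj_on fin) simp
  then have bij: "bij_betw F ?S ?S" using img by (simp add: bij_betw_def)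
  have "(\<Sum>\<omega>\<in>complete_configs n. \<Sum>i\<in>{0..n}.
      q \<alpha> \<beta> \<gamma> \<omega> * rate n \<alpha> \<beta> \<gamma> i * of_bool (T \<omega> i = \<omega>'))
    = (\<Sum>s\<in>?S. w s * of_bool (fst (F s) = \<omega>'))"
    unfolding sum.cartesian_product by (intro sum.cong) (auto simp: w_def F_def)
  \<comment> \<open>Invariance of \<open>w\<close> makes the summand a function of
    \<open>F s\<close>; after reindexing, all walls of the single state \<omega>' remain.\<close>
  also have "\<dots> = (\<Sum>s\<in>?S. w (F s) * of_bool (fst (F s) = \<omega>'))"
    using into by (intro sum.cong) auto
  also have "\<dots> = (\<Sum>s\<in>?S. w s * of_bool (fst s = \<omega>'))"
    by (rule sum.reindex_bij_betw[OF bij])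
  also have "\<dots> = (\<Sum>\<omega>\<in>complete_configs n. \<Sum>i\<in>{0..n}. w (\<omega>, i) * of_bool (\<omega> = \<omega>'))"
    unfolding sum.cartesian_product by (intro sum.cong) auto
  also have "\<dots> = (\<Sum>\<omega>\<in>complete_configs n. of_bool (\<omega> = \<omega>') * (\<Sum>i\<in>{0..n}. w (\<omega>, i)))"
    by (simp add: sum_distrib_left mult.commute)
  also have "\<dots> = (\<Sum>\<omega>\<in>complete_configs n. if \<omega> = \<omega>' then (\<Sum>i\<in>{0..n}. w (\<omega>, i)) else 0)"
    by (intro sum.cong) auto
  also have "\<dots> = (\<Sum>i\<in>{0..n}. w (\<omega>', i))"
    using finite_complete_configs[of n] \<omega>' by (simp add: sum.delta')
  finally show ?thesis by (simp add: w_def sum_distrib_left)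
qed

section \<open>Convergence of finite Markov chains\<close>

definition run :: "('a \<Rightarrow> 'a pmf) \<Rightarrow> 'a pmf \<Rightarrow> nat \<Rightarrow> 'a pmf" where
  "run K p s = ((\<lambda>p. bind_pmf p K) ^^ s) p"

lemma run_simps [simp]: "run K p 0 = p" "run K p (Suc s) = bind_pmf (run K p s) K"
  by (simp_all add: run_def)

text \<open>The Chapman-Kolmogorov equation; it lets \<open>t\<close> steps be treated as one step
  of another kernel.\<close>

lemma run_add: "run K p (s + t) = bind_pmf (run K p s) (\<lambda>x. run K (return_pmf x) t)"
  by (induction t) (simp_all add: bind_return_pmf' bind_assoc_pmf)

lemma run_support:
  assumes "\<And>x. x \<in> S \<Longrightarrow> set_pmf (K x) \<subseteq> S" "set_pmf p \<subseteq> S"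
  shows "set_pmf (run K p s) \<subseteq> S"
proof (induction s)
  case (Suc s)
  then show ?case using assms(1) unfolding run_simps set_bind_pmf by (intro UN_least) blast
qed (use assms(2) in simp)

lemma pmf_bind_finite:
  assumes "finite S" "set_pmf p \<subseteq> S"
  shows "pmf (bind_pmf p K) y = (\<Sum>x\<in>S. pmf p x * pmf (K x) y)"
  using assms by (subst pmf_bind, subst integral_measure_pmf_real[of S]) (auto simp: mult.commute)

text \<open>All rows of the kernel have mass at least \<epsilon> at \<open>z\<close>. Removing this
  common part leaves a nonnegative kernel \<open>L\<close> with row sums 1 - \<epsilon>, and the
  removed part does not act on the difference \<open>d\<close>, whose total mass is 0.\<close>

lemma doeblin_contraction:
  assumes fin: "finite S" and supp: "set_pmf p \<subseteq> S" "set_pmf r \<subseteq> S" "\<And>x. x \<in> S \<Longrightarrow> set_pmf (K x) \<subseteq> S"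
    and z: "z \<in> S" and e: "0 \<le> \<epsilon>" "\<And>x. x \<in> S \<Longrightarrow> \<epsilon> \<le> pmf (K x) z"
  shows "(\<Sum>y\<in>S. \<bar>pmf (bind_pmf p K) y - pmf (bind_pmf r K) y\<bar>)
    \<le> (1 - \<epsilon>) * (\<Sum>x\<in>S. \<bar>pmf p x - pmf r x\<bar>)"
proof -
  define d where "d = (\<lambda>x. pmf p x - pmf r x)"
  define L where "L = (\<lambda>x y. pmf (K x) y - (if y = z then \<epsilon> else 0))"
  have d0: "(\<Sum>x\<in>S. d x) = 0"
    using sum_pmf_eq_1[OF fin supp(1)] sum_pmf_eq_1[OF fin supp(2)] by (simp add: d_def sum_subtractf)
  have diff: "pmf (bind_pmf p K) y - pmf (bind_pmf r K) y = (\<Sum>x\<in>S. d x * L x y)" for y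
  proof -
    have "pmf (bind_pmf p K) y - pmf (bind_pmf r K) y = (\<Sum>x\<in>S. d x * pmf (K x) y)"
      unfolding pmf_bind_finite[OF fin supp(1)] pmf_bind_finite[OF fin supp(2)]
      by (simp add: d_def sum_subtractf left_diff_distrib)
    also have "\<dots> = (\<Sum>x\<in>S. d x * pmf (K x) y) - (\<Sum>x\<in>S. d x) * (if y = z then \<epsilon> else 0)"
      by (simp add: d0)
    also have "\<dots> = (\<Sum>x\<in>S. d x * L x y)"
      by (simp only: sum_distrib_right L_def right_diff_distrib sum_subtractf)
    finally show ?thesis .
  qed
  have L0: "0 \<le> L x y" if "x \<in> S" for x y
    using e(2)[OF that] by (auto simp: L_def)
  have L1: "(\<Sum>y\<in>S. L x y) = 1 - \<epsilon>" if "x \<in> S" for x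
    using sum_pmf_eq_1[OF fin supp(3)[OF that]] fin z by (simp add: L_def sum_subtractf sum.delta')
  have "(\<Sum>y\<in>S. \<bar>pmf (bind_pmf p K) y - pmf (bind_pmf r K) y\<bar>) \<le> (\<Sum>y\<in>S. \<Sum>x\<in>S. \<bar>d x\<bar> * L x y)"
  proof (rule sum_mono)
    fix y assume "y \<in> S"
    have "\<bar>\<Sum>x\<in>S. d x * L x y\<bar> \<le> (\<Sum>x\<in>S. \<bar>d x * L x y\<bar>)" by (rule sum_abs)
    also have "\<dots> = (\<Sum>x\<in>S. \<bar>d x\<bar> * L x y)"
      by (intro sum.cong) (simp_all add: abs_mult L0)
    finally show "\<bar>pmf (bind_pmf p K) y - pmf (bind_pmf r K) y\<bar> \<le> (\<Sum>x\<in>S. \<bar>d x\<bar> * L x y)"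
      by (simp add: diff)
  qed
  also have "\<dots> = (\<Sum>x\<in>S. \<bar>d x\<bar> * (\<Sum>y\<in>S. L x y))"
    by (subst sum.swap) (simp add: sum_distrib_left)
  also have "\<dots> = (1 - \<epsilon>) * (\<Sum>x\<in>S. \<bar>d x\<bar>)"
    by (simp add: L1 sum_distrib_left mult.commute)
  finally show ?thesis by (simp add: d_def)
qed

text \<open>The distances to \<pi> decrease to a limit \<open>L\<close>; the contraction over
  \<open>N\<close> steps gives \<open>L \<le> (1 - \<epsilon>) * L\<close>, hence
  \<open>L = 0\<close> without estimating powers of 1 - \<epsilon>.\<close>

lemma finite_chain_converges:
  assumes fin: "finite S" and K: "\<And>x. x \<in> S \<Longrightarrow> set_pmf (K x) \<subseteq> S"
    and z: "z \<in> S" "z \<in> set_pmf (K z)"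
    and reach: "\<And>x. x \<in> S \<Longrightarrow> \<exists>s. z \<in> set_pmf (run K (return_pmf x) s)"
    and \<pi>: "set_pmf \<pi> \<subseteq> S" "bind_pmf \<pi> K = \<pi>" and \<mu>: "set_pmf \<mu> \<subseteq> S" and x: "x \<in> S"
  shows "(\<lambda>s. pmf (run K \<mu> s) x) \<longlonglongrightarrow> pmf \<pi> x"
proof -
  obtain f where f: "\<And>x. x \<in> S \<Longrightarrow> z \<in> set_pmf (run K (return_pmf x) (f x))"
    using reach by metis
  \<comment> \<open>The self-loop allows waiting at \<open>z\<close>, so the arrival times
    \<open>f x\<close> can be raised to one common time \<open>N\<close>.\<close>
  have stay: "z \<in> set_pmf (run K (return_pmf x) (f x + t))" if "x \<in> S" for x t
  proof (induction t)
    case (Suc t)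
    then show ?case using z(2) by (auto simp: set_bind_pmf)
  qed (use f that in simp)
  define N where "N = Max (f ` S)"
  have "z \<in> set_pmf (run K (return_pmf x) N)" if "x \<in> S" for x
  proof -
    have "f x \<le> N" unfolding N_def using fin that by simp
    then show ?thesis using stay[OF that, of "N - f x"] by simp
  qed
  then have pos: "0 < pmf (run K (return_pmf x) N) z" if "x \<in> S" for x
    using that by (simp add: pmf_positive)
  define \<epsilon> where "\<epsilon> = Min ((\<lambda>x. pmf (run K (return_pmf x) N) z) ` S)"
  have \<epsilon>: "0 < \<epsilon>" "\<And>x. x \<in> S \<Longrightarrow> \<epsilon> \<le> pmf (run K (return_pmf x) N) z"
  proof -
    show "0 < \<epsilon>" unfolding \<epsilon>_def using fin pos z(1) by (subst Min_gr_iff) auto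
    show "\<epsilon> \<le> pmf (run K (return_pmf x) N) z" if "x \<in> S" for x
      unfolding \<epsilon>_def using fin that by (intro Min_le) auto
  qed
  define D where "D = (\<lambda>s. \<Sum>x\<in>S. \<bar>pmf (run K \<mu> s) x - pmf \<pi> x\<bar>)"
  have supp: "set_pmf (run K \<mu> s) \<subseteq> S" for s
    by (rule run_support[OF K \<mu>])
  have \<pi>N: "run K \<pi> t = \<pi>" for t
    by (induction t) (simp_all add: \<pi>(2))
  \<comment> \<open>A single step need not contract; the bound with \<epsilon> = 0 already makes the
    distances monotone.\<close>
  have "D (Suc s) \<le> D s" for s
    using doeblin_contraction[of S "run K \<mu> s" \<pi> K z 0, OF fin supp \<pi>(1) K z(1)]
    by (simp add: D_def \<pi>(2))
  then have "decseq D" by (rule decseq_SucI)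
  moreover have "\<forall>s. 0 \<le> D s" by (simp add: D_def sum_nonneg)
  ultimately obtain L where L: "D \<longlonglongrightarrow> L" "\<forall>s. L \<le> D s"
    using decseq_convergent by blast
  have "0 \<le> L" using L(1) by (rule LIMSEQ_le_const) (simp add: D_def sum_nonneg)
  have "D (s + N) \<le> (1 - \<epsilon>) * D s" for s
  proof -
    have "set_pmf (run K (return_pmf x) N) \<subseteq> S" if "x \<in> S" for x
      by (rule run_support[OF K]) (use that in auto)
    moreover have "bind_pmf \<pi> (\<lambda>x. run K (return_pmf x) N) = \<pi>"
      using run_add[of K \<pi> 0 N] \<pi>N by simp
    ultimately show ?thesis
      using doeblin_contraction[of S "run K \<mu> s" \<pi> "\<lambda>x. run K (return_pmf x) N" z \<epsilon>,
          OF fin supp \<pi>(1) _ z(1)] \<epsilon>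
      by (simp add: D_def run_add)
  qed
  then have "L \<le> (1 - \<epsilon>) * L"
    by (intro LIMSEQ_le[OF LIMSEQ_ignore_initial_segment[OF L(1), of N] tendsto_mult_left[OF L(1)]]) blast
  then have "\<epsilon> * L \<le> 0" by (simp add: algebra_simps)
  then have "L = 0" using \<epsilon>(1) \<open>0 \<le> L\<close> by (simp add: mult_le_0_iff)
  then have "D \<longlonglongrightarrow> 0" using L(1) by simp
  moreover have "\<bar>pmf (run K \<mu> s) x - pmf \<pi> x\<bar> \<le> D s" for s
    unfolding D_def using member_le_sum[OF x _ fin, of "\<lambda>x. \<bar>pmf (run K \<mu> s) x - pmf \<pi> x\<bar>"] by simp
  then have "\<forall>\<^sub>F s in sequentially. norm (pmf (run K \<mu> s) x - pmf \<pi> x) \<le> D s" by simp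
  ultimately have "(\<lambda>s. pmf (run K \<mu> s) x - pmf \<pi> x) \<longlonglongrightarrow> 0"
    by (rule Lim_null_comparison[rotated])
  then show ?thesis by (rule LIM_zero_cancel)
qed

lemma exists_pmf:
  fixes f :: "'a \<Rightarrow> real"
  assumes "finite S" "\<And>x. x \<in> S \<Longrightarrow> 0 \<le> f x" "(\<Sum>x\<in>S. f x) = 1"
  shows "\<exists>p. set_pmf p \<subseteq> S \<and> (\<forall>x\<in>S. pmf p x = f x)"
proof -
  define g where "g = (\<lambda>x. if x \<in> S then f x else 0)"
  have g0: "\<And>x. 0 \<le> g x" using assms(2) by (simp add: g_def)
  have "(\<integral>\<^sup>+x. ennreal (g x) \<partial>count_space UNIV) = (\<Sum>x\<in>S. ennreal (g x))"
    by (rule nn_integral_count_space') (auto simp: assms(1) g_def)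
  also have "\<dots> = ennreal (\<Sum>x\<in>S. g x)" by (rule sum_ennreal) (rule g0)
  also have "(\<Sum>x\<in>S. g x) = 1" using assms(3) by (simp add: g_def)
  finally have g1: "(\<integral>\<^sup>+x. ennreal (g x) \<partial>count_space UNIV) = 1" by simp
  show ?thesis
  proof (intro exI[of _ "embed_pmf g"] conjI ballI)
    show "set_pmf (embed_pmf g) \<subseteq> S" using set_embed_pmf[OF g0 g1] by (auto simp: g_def)
    show "pmf (embed_pmf g) x = f x" if "x \<in> S" for x
      using pmf_embed_pmf[OF g0 g1] that by (simp add: g_def)
  qed
qed

section \<open>The chain on complete configurations\<close>

lemma chain_run: "chain n \<alpha> \<beta> \<gamma> \<mu> s = run (step n \<alpha> \<beta> \<gamma>) \<mu> s"
  by (induction s) simp_all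

context
  fixes n :: nat and \<alpha> \<beta> \<gamma> :: real
  assumes n: "n \<ge> 1" and rates: "0 < \<alpha>" "\<alpha> \<le> 1" "0 < \<beta>" "\<beta> \<le> 1" "0 < \<gamma>" "\<gamma> \<le> 1"
begin

lemma rate_bounds: "0 < rate n \<alpha> \<beta> \<gamma> i" "rate n \<alpha> \<beta> \<gamma> i \<le> 1"
  by (simp_all add: rate_def rates)

lemma pmf_step:
  "pmf (step n \<alpha> \<beta> \<gamma> \<omega>) \<omega>' = (\<Sum>i\<in>{0..n}. rate n \<alpha> \<beta> \<gamma> i * of_bool (T \<omega> i = \<omega>')
      + (1 - rate n \<alpha> \<beta> \<gamma> i) * of_bool (\<omega> = \<omega>')) / (n + 1)"
proof -
  have "pmf (map_pmf (\<lambda>accept. if accept then T \<omega> i else \<omega>) (bernoulli_pmf (rate n \<alpha> \<beta> \<gamma> i))) \<omega>'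
    = rate n \<alpha> \<beta> \<gamma> i * of_bool (T \<omega> i = \<omega>') + (1 - rate n \<alpha> \<beta> \<gamma> i) * of_bool (\<omega> = \<omega>')" for i
    using rate_bounds[of i]
    by (simp add: map_pmf_def pmf_bind indicator_def mult.commute)
  then show ?thesis
    unfolding step_def by (subst pmf_bind_pmf_of_set) (simp_all add: sum_divide_distrib)
qed

lemma set_step:
  assumes "\<omega> \<in> complete_configs n"
  shows "set_pmf (step n \<alpha> \<beta> \<gamma> \<omega>) \<subseteq> complete_configs n"
proof
  fix \<omega>' assume "\<omega>' \<in> set_pmf (step n \<alpha> \<beta> \<gamma> \<omega>)"
  then obtain i where "i \<le> n" "\<omega>' = T \<omega> i \<or> \<omega>' = \<omega>"
    unfolding step_def by (auto simp: set_bind_pmf set_pmf_of_set split: if_splits)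
  then show "\<omega>' \<in> complete_configs n" using T_complete[OF n assms] assms by blast
qed

lemma T_in_set_step:
  assumes "i \<le> n"
  shows "T \<omega> i \<in> set_pmf (step n \<alpha> \<beta> \<gamma> \<omega>)"
proof -
  have "pmf (bernoulli_pmf (rate n \<alpha> \<beta> \<gamma> i)) True > 0"
    using rate_bounds[of i] by simp
  then have "True \<in> set_pmf (bernoulli_pmf (rate n \<alpha> \<beta> \<gamma> i))"
    by (simp add: set_pmf_iff)
  then show ?thesis
    unfolding step_def set_bind_pmf set_map_pmf using assms
    by (intro UN_I[of i] image_eqI[where x = True]) (simp_all add: set_pmf_of_set)
qed

lemma q_pos: "0 < q \<alpha> \<beta> \<gamma> \<omega>"
  unfolding q_def by (intro mult_pos_pos zero_less_power rates)

text \<open>On the top row the chain is a TASEP, so the leftmost white particle can always be driven out to the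
  left; hence the configuration with an all-black top row is reachable from every state.\<close>

definition full :: "column list" where
  "full = replicate n (Black, White)"

lemma full_complete: "config_of full \<in> complete_configs n"
proof -
  have "balanced 0 (replicate k (Black, White))" for k by (induction k) simp_all
  then show ?thesis by (simp add: full_def)
qed

lemma full_step: "config_of full \<in> set_pmf (step n \<alpha> \<beta> \<gamma> (config_of full))"
proof -
  have "\<not> active full 0" "full \<noteq> []" using n by (auto simp: active_def full_def)
  then have "T (config_of full) 0 = config_of full" using inactive_T[of full 0] by simp
  then show ?thesis using T_in_set_step[of 0 "config_of full"] by simp
qed

text \<open>Peeling from the right: \<open>last_column\<close> determines the last column, and
  removing a \<open>(Black, White)\<close> column preserves balance.\<close>

lemma all_tops_Black:
  assumes "balanced 0 cs" "tops cs \<subseteq> {Black}" "length cs = n"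
  shows "cs = full"
proof -
  have "\<forall>c\<in>set cs. c = (Black, White)" if "balanced h cs" "0 \<le> h" "tops cs \<subseteq> {Black}" for h
    using that
  proof (induction cs arbitrary: h rule: rev_induct)
    case (snoc c cs)
    then have c: "c = (Black, White)" using last_column[of h cs c] by simp
    then show ?case using snoc.IH[of h] snoc.prems balanced_back[of h cs] by simp
  qed simp
  from this[of 0] assms have "\<forall>c\<in>set cs. c = (Black, White)" by simp
  then show ?thesis unfolding full_def by (intro replicate_eqI assms(3)) blast
qed

text \<open>The lexicographic measure is the number of white tops, then the length of the initial
  black run. In column 1 the leftmost white top is driven out, which lowers the first component;
  elsewhere it moves one cell to the left, which keeps the first and lowers the second.\<close>

lemma reach_full:
  assumes "balanced 0 cs" "length cs = n"
  shows "\<exists>s. config_of full \<in> set_pmf (run (step n \<alpha> \<beta> \<gamma>) (return_pmf (config_of cs)) s)"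
  using assms
proof (induction cs rule: wf_induct[OF wf_measures[of "[\<lambda>cs. count_list (map fst cs) White,
      \<lambda>cs. length (takeWhile (\<lambda>c. fst c = Black) cs)]"]])
  case (1 cs)
  have step: ?case if m: "move cs i ds j" and less: "(ds, cs) \<in> measures [\<lambda>cs. count_list (map fst cs) White,
      \<lambda>cs. length (takeWhile (\<lambda>c. fst c = Black) cs)]" for i ds j
  proof -
    note inv = move_invariants[OF m disjI1[OF 1(2)]]
    have "length ds = n" using inv(3) 1(3) by simp
    then obtain s where s: "config_of full \<in> set_pmf (run (step n \<alpha> \<beta> \<gamma>) (return_pmf (config_of ds)) s)"
      using 1(1)[rule_format, OF less inv(2)] by blast
    have "cs \<noteq> []" using 1(3) n by auto
    then have "config_of ds \<in> set_pmf (step n \<alpha> \<beta> \<gamma> (config_of cs))"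
      using move_T[OF m] T_in_set_step[of i "config_of cs"] inv(4) 1(3) by simp
    then have "config_of full \<in> set_pmf (run (step n \<alpha> \<beta> \<gamma>) (return_pmf (config_of cs)) (1 + s))"
      using s unfolding run_add by (auto simp: set_bind_pmf bind_return_pmf)
    then show ?thesis by blast
  qed
  have tw: "takeWhile (\<lambda>c. fst c = Black) (A @ ds) = A @ takeWhile (\<lambda>c. fst c = Black) ds"
    if "tops A \<subseteq> {Black}" for A ds :: "column list"
    using that by (intro takeWhile_append2) auto
  show ?case
    using split_first_White[of cs]
  proof cases
    case 1
    then have "cs = full" using all_tops_Black "1.prems" by simp
    then show ?thesis by (intro exI[of _ 0]) simp
  next
    case (2 A y C)
    show ?thesis
    proof (cases A rule: rev_cases)
      case Nil
      have y: "(White, y) = (White, Black)" using first_column[of "(White, y)" C] "1.prems"(1) 2 Nil by simp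
      show ?thesis
        using split_first_White[of C]
      proof cases
        case 1
        show ?thesis
          by (rule step[of 0 "C @ [(Black, White)]" "length C + 1"])
            (use move.enter_end[OF 1] 2 Nil y in auto)
      next
        case R: (2 R w C')
        show ?thesis
          by (rule step[of 0 "R @ (Black, w) # (White, White) # C'" "length R + 1"])
            (use move.enter[OF R(2), of w C'] R 2 Nil y in auto)
      qed
    next
      case (snoc B c)
      then obtain x where c: "c = (Black, x)" using 2(2) by (cases c) auto
      have B: "tops B \<subseteq> {Black}" "black_end B"
      proof -
        show "tops B \<subseteq> {Black}" using 2(2) snoc by simp
        then show "black_end B" by (cases B rule: rev_cases) (simp_all add: black_end_def)
      qed
      have cs: "cs = B @ (Black, x) # (White, y) # C" using 2 snoc c by simp
      show ?thesis
      proof (cases y)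
        case Black
        \<comment> \<open>All tops of \<open>B\<close> are black, so the run jumped over is empty
          and the column advances by one place.\<close>
        show ?thesis
          by (rule step[of "length B + 1" "B @ (White, Black) # (Black, x) # C" "length B"])
            (use move.WB[OF B(2), of "[]" x C] cs Black tw[OF B(1)] in auto)
      next
        case White
        show ?thesis
          using split_first_White[of C]
        proof cases
          case 1
          show ?thesis
            by (rule step[of "length B + 1" "B @ (White, x) # C @ [(Black, White)]" "length B + length C + 2"])
              (use move.WW_end[OF 1, of B x] cs White tw[OF B(1)] in auto)
        next
          case R: (2 R w C')
          show ?thesis
            by (rule step[of "length B + 1" "B @ (White, x) # R @ (Black, w) # (White, White) # C'"
                  "length B + length R + 2"])
              (use move.WW[OF R(2), of B x w C'] R cs White tw[OF B(1)] in auto)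
        qed
      qed
    qed
  qed
qed

section \<open>The normalised weights as the stationary law\<close>

lemma Z_pos: "0 < Z n \<alpha> \<beta> \<gamma>"
  unfolding Z_def using full_complete[THEN ex_in_conv[THEN iffD1, OF exI]]
  by (intro sum_pos finite_complete_configs q_pos)

text \<open>Global balance turns the inflow by accepted moves into the weight of \<omega>' times the
  sum of the rates; rejections contribute the complements. Together they give \<open>n + 1\<close>,
  which cancels the uniform choice of the wall.\<close>

lemma stationary_of_weights:
  assumes \<pi>: "set_pmf \<pi> \<subseteq> complete_configs n"
    and eq: "\<And>\<omega>. \<omega> \<in> complete_configs n \<Longrightarrow> pmf \<pi> \<omega> = q \<alpha> \<beta> \<gamma> \<omega> / Z n \<alpha> \<beta> \<gamma>"
  shows "bind_pmf \<pi> (step n \<alpha> \<beta> \<gamma>) = \<pi>"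
proof (rule pmf_eqI)
  fix \<omega>'
  let ?S = "complete_configs n" and ?r = "rate n \<alpha> \<beta> \<gamma>"
  note fin = finite_complete_configs[of n]
  show "pmf (bind_pmf \<pi> (step n \<alpha> \<beta> \<gamma>)) \<omega>' = pmf \<pi> \<omega>'"
  proof (cases "\<omega>' \<in> ?S")
    case False
    then have "\<omega>' \<notin> set_pmf (bind_pmf \<pi> (step n \<alpha> \<beta> \<gamma>))" "\<omega>' \<notin> set_pmf \<pi>"
      using \<pi> set_step by (auto simp: set_bind_pmf)
    then show ?thesis by (simp only: set_pmf_iff not_not)
  next
    case True
    \<comment> \<open>The constant collects both normalisations, the sum of weights and the number
      of walls.\<close>
    define c where "c = Z n \<alpha> \<beta> \<gamma> * (n + 1)"
    have c: "c \<noteq> 0" using Z_pos by (simp add: c_def)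
    have "pmf (bind_pmf \<pi> (step n \<alpha> \<beta> \<gamma>)) \<omega>' = (\<Sum>\<omega>\<in>?S. pmf \<pi> \<omega> * pmf (step n \<alpha> \<beta> \<gamma> \<omega>) \<omega>')"
      by (rule pmf_bind_finite[OF fin \<pi>])
    also have "\<dots> = (\<Sum>\<omega>\<in>?S. (\<Sum>i\<in>{0..n}. q \<alpha> \<beta> \<gamma> \<omega> * ?r i * of_bool (T \<omega> i = \<omega>'))
         + (if \<omega> = \<omega>' then q \<alpha> \<beta> \<gamma> \<omega> * (\<Sum>i\<in>{0..n}. 1 - ?r i) else 0)) / c"
      unfolding sum_divide_distrib[of _ ?S]
    proof (rule sum.cong[OF refl])
      fix \<omega> assume \<omega>: "\<omega> \<in> ?S"
      have expand: "x * (\<Sum>i\<in>{0..n}. ?r i * f i + (1 - ?r i) * b)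
          = (\<Sum>i\<in>{0..n}. x * ?r i * f i) + b * (x * (\<Sum>i\<in>{0..n}. 1 - ?r i))" for x b :: real and f
        unfolding sum_distrib_left sum.distrib[symmetric]
        by (intro sum.cong refl) (simp add: algebra_simps)
      have "q \<alpha> \<beta> \<gamma> \<omega> * (\<Sum>i\<in>{0..n}. ?r i * of_bool (T \<omega> i = \<omega>') + (1 - ?r i) * of_bool (\<omega> = \<omega>'))
        = (\<Sum>i\<in>{0..n}. q \<alpha> \<beta> \<gamma> \<omega> * ?r i * of_bool (T \<omega> i = \<omega>'))
         + (if \<omega> = \<omega>' then q \<alpha> \<beta> \<gamma> \<omega> * (\<Sum>i\<in>{0..n}. 1 - ?r i) else 0)"
        unfolding expand by (cases "\<omega> = \<omega>'") (simp_all only: of_bool_eq refl if_True if_False mult_1 mult_zero_left)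
      then show "pmf \<pi> \<omega> * pmf (step n \<alpha> \<beta> \<gamma> \<omega>) \<omega>' =
          ((\<Sum>i\<in>{0..n}. q \<alpha> \<beta> \<gamma> \<omega> * ?r i * of_bool (T \<omega> i = \<omega>'))
         + (if \<omega> = \<omega>' then q \<alpha> \<beta> \<gamma> \<omega> * (\<Sum>i\<in>{0..n}. 1 - ?r i) else 0)) / c"
        unfolding eq[OF \<omega>] pmf_step c_def by (simp only: times_divide_times_eq)
    qed
    also have "\<dots> = (q \<alpha> \<beta> \<gamma> \<omega>' * (\<Sum>i\<in>{0..n}. ?r i) + q \<alpha> \<beta> \<gamma> \<omega>' * (\<Sum>i\<in>{0..n}. 1 - ?r i)) / c"
      unfolding sum.distrib[of _ _ ?S] global_balance[OF n True] using fin True by simp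
    also have "\<dots> = q \<alpha> \<beta> \<gamma> \<omega>' * (n + 1) / c"
      by (simp only: distrib_left[symmetric] sum.distrib[symmetric]) simp
    also have "\<dots> = pmf \<pi> \<omega>'" using eq[OF True] by (simp add: c_def)
    finally show ?thesis .
  qed
qed

text \<open>Here \<pi> is any stationary law, so that the lemma can also be used to compare two of
  them.\<close>

lemma chain_limit:
  assumes "stationary n \<alpha> \<beta> \<gamma> \<pi>" "set_pmf \<mu> \<subseteq> complete_configs n" "\<omega> \<in> complete_configs n"
  shows "(\<lambda>s. pmf (chain n \<alpha> \<beta> \<gamma> \<mu> s) \<omega>) \<longlonglongrightarrow> pmf \<pi> \<omega>"
  unfolding chain_run
proof (rule finite_chain_converges[of "complete_configs n" _ "config_of full"])
  show "\<exists>s. config_of full \<in> set_pmf (run (step n \<alpha> \<beta> \<gamma>) (return_pmf x) s)"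
    if "x \<in> complete_configs n" for x
  proof -
    from that obtain cs where "x = config_of cs" "length cs = n" "balanced 0 cs"
      unfolding complete_configs_eq by blast
    then show ?thesis using reach_full by simp
  qed
  show "set_pmf \<pi> \<subseteq> complete_configs n" "bind_pmf \<pi> (step n \<alpha> \<beta> \<gamma>) = \<pi>"
    using assms(1) by (simp_all add: stationary_def)
qed (fact finite_complete_configs set_step full_complete full_step assms)+

lemma exists_stationary:
  "\<exists>\<pi>. stationary n \<alpha> \<beta> \<gamma> \<pi> \<and>
    (\<forall>\<omega>\<in>complete_configs n. pmf \<pi> \<omega> = q \<alpha> \<beta> \<gamma> \<omega> / Z n \<alpha> \<beta> \<gamma>)"
proof -
  have "0 \<le> q \<alpha> \<beta> \<gamma> \<omega> / Z n \<alpha> \<beta> \<gamma>" for \<omega> using q_pos[of \<omega>] Z_pos by simp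
  moreover have "(\<Sum>\<omega>\<in>complete_configs n. q \<alpha> \<beta> \<gamma> \<omega> / Z n \<alpha> \<beta> \<gamma>) = 1"
    using Z_pos by (simp add: Z_def flip: sum_divide_distrib)
  ultimately obtain \<pi> where \<pi>: "set_pmf \<pi> \<subseteq> complete_configs n"
      "\<forall>\<omega>\<in>complete_configs n. pmf \<pi> \<omega> = q \<alpha> \<beta> \<gamma> \<omega> / Z n \<alpha> \<beta> \<gamma>"
    using exists_pmf[OF finite_complete_configs[of n], of "\<lambda>\<omega>. q \<alpha> \<beta> \<gamma> \<omega> / Z n \<alpha> \<beta> \<gamma>"] by blast
  then have "bind_pmf \<pi> (step n \<alpha> \<beta> \<gamma>) = \<pi>" by (intro stationary_of_weights bspec[OF \<pi>(2)])
  then show ?thesis using \<pi> unfolding stationary_def by (intro exI[of _ \<pi>] conjI)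
qed

text \<open>Started from \<pi>' the chain has constant law, yet this law converges to \<pi>.\<close>

lemma stationary_unique:
  assumes "stationary n \<alpha> \<beta> \<gamma> \<pi>" "stationary n \<alpha> \<beta> \<gamma> \<pi>'"
  shows "\<pi>' = \<pi>"
proof (rule pmf_eqI)
  fix \<omega>
  show "pmf \<pi>' \<omega> = pmf \<pi> \<omega>"
  proof (cases "\<omega> \<in> complete_configs n")
    case True
    have "chain n \<alpha> \<beta> \<gamma> \<pi>' s = \<pi>'" for s
      using assms(2) by (induction s) (simp_all add: stationary_def)
    then show ?thesis
      using chain_limit[OF assms(1) _ True, of \<pi>'] assms(2)
      by (simp add: stationary_def LIMSEQ_const_iff)
  next
    case False
    then have "\<omega> \<notin> set_pmf \<pi>'" "\<omega> \<notin> set_pmf \<pi>" using assms by (auto simp: stationary_def)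
    then show ?thesis by (simp add: set_pmf_iff)
  qed
qed

end

theorem theorem4:
  fixes n :: nat and \<alpha> \<beta> \<gamma> :: real
  assumes "n \<ge> 1"
    and "0 < \<alpha>" "\<alpha> \<le> 1" "0 < \<beta>" "\<beta> \<le> 1" "0 < \<gamma>" "\<gamma> \<le> 1"
  shows "(\<exists>!\<pi>. stationary n \<alpha> \<beta> \<gamma> \<pi>) \<and>
    (\<forall>\<mu> \<omega>. set_pmf \<mu> \<subseteq> complete_configs n \<longrightarrow> \<omega> \<in> complete_configs n \<longrightarrow>
      (\<lambda>s. pmf (chain n \<alpha> \<beta> \<gamma> \<mu> s) \<omega>) \<longlonglongrightarrow> q \<alpha> \<beta> \<gamma> \<omega> / Z n \<alpha> \<beta> \<gamma>)"
proof -
  obtain \<pi> where \<pi>: "stationary n \<alpha> \<beta> \<gamma> \<pi>"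
    "\<forall>\<omega>\<in>complete_configs n. pmf \<pi> \<omega> = q \<alpha> \<beta> \<gamma> \<omega> / Z n \<alpha> \<beta> \<gamma>"
    using exists_stationary[OF assms] by (elim exE conjE)
  have "\<exists>!\<pi>. stationary n \<alpha> \<beta> \<gamma> \<pi>"
    using \<pi>(1) stationary_unique[OF assms \<pi>(1)] by (rule ex1I)
  moreover have "(\<lambda>s. pmf (chain n \<alpha> \<beta> \<gamma> \<mu> s) \<omega>) \<longlonglongrightarrow> q \<alpha> \<beta> \<gamma> \<omega> / Z n \<alpha> \<beta> \<gamma>"
    if "set_pmf \<mu> \<subseteq> complete_configs n" "\<omega> \<in> complete_configs n" for \<mu> \<omega>
    using chain_limit[OF assms \<pi>(1) that] bspec[OF \<pi>(2) that(2)] by simp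
  ultimately show ?thesis by simp
qed

end
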